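(* There is an $O(m|B|)$ time algorithm that, given an unweighted undirected graph $G=(V,E)$ with $m$ edges and $S\subseteq V$ with $T=V\setminus S$, outputs for every $v\in S$ an estimate $\varepsilon'(v)$ such that $\tfrac{3}{5}\varepsilon_{ST}(v)-1\leq\varepsilon'(v)\leq\varepsilon_{ST}(v)$.
   Context: $d(u,v)$ denotes the shortest path distance in $G$. For $v\in S$, $\varepsilon_{ST}(v)=\max_{u\in T}d(v,u)$. Let $S'$ be the set of vertices of $S$ that have a neighbor in $T$, and $T'$ the set of vertices of $T$ that have a neighbor in $S$. The boundary $B$ is whichever of $S'$ and $T'$ is smaller in size.
   Formalization: The bound O(m|B|) is stated for connected G with S nonempty; other graphs get O((n+m)(|B|+1)), since m|B| can be 0 (e.g. no edges) while output is still required. T is assumed nonempty so that the maximum exists; infinite eccentricities must be reported as infinite. *)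

theory Defs
  imports "HOL-Library.Extended_Real"
begin

section \<open>Undirected graphs, distances, eccentricities, the boundary\<close>

definition simple_graph :: "'a set \<Rightarrow> 'a set set \<Rightarrow> bool" where
  "simple_graph V E \<longleftrightarrow> finite V \<and> E \<subseteq> {{u, v} | u v. u \<in> V \<and> v \<in> V \<and> u \<noteq> v}"

definition adj_rel :: "'a set set \<Rightarrow> ('a \<times> 'a) set" where
  "adj_rel E = {(u, v). {u, v} \<in> E}"

definition connected_graph :: "'a set \<Rightarrow> 'a set set \<Rightarrow> bool" where
  "connected_graph V E \<longleftrightarrow> (\<forall>u\<in>V. \<forall>v\<in>V. (u, v) \<in> (adj_rel E)\<^sup>*)"

(* The relation power "adj_rel E ^^ k" relates the endpoints of walks with k edges.
   The infimum of the empty set is \<infinity>, the distance between different components. *)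
definition gdist :: "'a set set \<Rightarrow> 'a \<Rightarrow> 'a \<Rightarrow> enat" where
  "gdist E u v = (INF k\<in>{k. (u, v) \<in> adj_rel E ^^ k}. enat k)"

(* Meaningful for finite nonempty T only. *)
definition ecc_to :: "'a set set \<Rightarrow> 'a set \<Rightarrow> 'a \<Rightarrow> enat" where
  "ecc_to E T v = Max (gdist E v ` T)"

definition border :: "'a set set \<Rightarrow> 'a set \<Rightarrow> 'a set \<Rightarrow> 'a set" where
  "border E X Y = {x\<in>X. \<exists>y\<in>Y. {x, y} \<in> E}"

(* A tie is resolved in favour of S; only the size of the boundary matters below. *)
definition boundary :: "'a set set \<Rightarrow> 'a set \<Rightarrow> 'a set \<Rightarrow> 'a set" where
  "boundary E S T =
     (if card (border E S T) \<le> card (border E T S) then border E S T else border E T S)"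


section \<open>A random access machine\<close>

(* A structured program over finitely many registers and arrays.  The only arithmetic is
   increment and (truncated) subtraction, so that no number can grow faster than the running
   time (lemma exec_bounded): on inputs of size N, polynomially many steps only
   produce numbers of O(log N) bits, and unit cost is the usual word RAM cost.
   Richer unit-cost operations (addition, shifts, ...) could only make algorithms faster. *)

datatype exp = Const nat | Reg nat | Cell nat exp | Inc exp | Sub exp exp

datatype test = Less exp exp | Neg test | Conj test test

datatype prog =
    Skip
  | Assign nat exp
  | Store nat exp exp  \<comment> \<open>array, index, value\<close>
  | Seq prog prog
  | Cond test prog prog
  | While test prog

record state =
  regs :: "nat \<Rightarrow> nat"
  arrs :: "nat \<Rightarrow> nat \<Rightarrow> nat"

fun eval_exp :: "exp \<Rightarrow> state \<Rightarrow> nat" where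
  "eval_exp (Const k) s = k"
| "eval_exp (Reg r) s = regs s r"
| "eval_exp (Cell a e) s = arrs s a (eval_exp e s)"
| "eval_exp (Inc e) s = Suc (eval_exp e s)"
| "eval_exp (Sub e f) s = eval_exp e s - eval_exp f s"

fun eval_test :: "test \<Rightarrow> state \<Rightarrow> bool" where
  "eval_test (Less e f) s \<longleftrightarrow> eval_exp e s < eval_exp f s"
| "eval_test (Neg b) s \<longleftrightarrow> \<not> eval_test b s"
| "eval_test (Conj b c) s \<longleftrightarrow> eval_test b s \<and> eval_test c s"

fun exp_cost :: "exp \<Rightarrow> nat" where
  "exp_cost (Const k) = 1"
| "exp_cost (Reg r) = 1"
| "exp_cost (Cell a e) = 1 + exp_cost e"
| "exp_cost (Inc e) = 1 + exp_cost e"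
| "exp_cost (Sub e f) = 1 + exp_cost e + exp_cost f"

fun test_cost :: "test \<Rightarrow> nat" where
  "test_cost (Less e f) = 1 + exp_cost e + exp_cost f"
| "test_cost (Neg b) = 1 + test_cost b"
| "test_cost (Conj b c) = 1 + test_cost b + test_cost c"

(* exec p s t s': started in s, program p halts in s' after exactly t time units. *)
inductive exec :: "prog \<Rightarrow> state \<Rightarrow> nat \<Rightarrow> state \<Rightarrow> bool" where
  Skip: "exec Skip s 1 s"
| Assign: "exec (Assign r e) s (1 + exp_cost e)
     (s\<lparr>regs := (regs s)(r := eval_exp e s)\<rparr>)"
| Store: "exec (Store a i e) s (1 + exp_cost i + exp_cost e)
     (s\<lparr>arrs := (arrs s)(a := (arrs s a)(eval_exp i s := eval_exp e s))\<rparr>)"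
| Seq: "exec p s t s' \<Longrightarrow> exec q s' u s'' \<Longrightarrow> exec (Seq p q) s (t + u) s''"
| CondTrue: "eval_test b s \<Longrightarrow> exec p s t s' \<Longrightarrow>
     exec (Cond b p q) s (1 + test_cost b + t) s'"
| CondFalse: "\<not> eval_test b s \<Longrightarrow> exec q s t s' \<Longrightarrow>
     exec (Cond b p q) s (1 + test_cost b + t) s'"
| WhileFalse: "\<not> eval_test b s \<Longrightarrow> exec (While b p) s (1 + test_cost b) s"
| WhileTrue: "eval_test b s \<Longrightarrow> exec p s t s' \<Longrightarrow> exec (While b p) s' u s'' \<Longrightarrow>
     exec (While b p) s (1 + test_cost b + t + u) s''"

inductive_cases exec_cases:
  "exec Skip s t s'" "exec (Assign r e) s t s'" "exec (Store a i e) s t s'"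
  "exec (Seq p q) s t s'" "exec (Cond b p q) s t s'" "exec (While b p) s t s'"

lemma exec_deterministic:
  "exec p s t s' \<Longrightarrow> exec p s u s'' \<Longrightarrow> t = u \<and> s' = s''"
proof (induction arbitrary: u s'' rule: exec.induct)
  case (Skip s)
  then show ?case by (rule exec_cases(1)) simp
next
  case (Assign r e s)
  then show ?case by (rule exec_cases(2)) simp
next
  case (Store a i e s)
  then show ?case by (rule exec_cases(3)) simp
next
  case (Seq p s t s' q u s'')
  from Seq.prems show ?case by (rule exec_cases(4)) (metis Seq.IH)
next
  case (CondTrue b s p t s' q)
  from CondTrue.prems show ?case by (rule exec_cases(5)) (metis CondTrue.IH CondTrue.hyps(1) plus_1_eq_Suc add_Suc)+
next
  case (CondFalse b s q t s' p)
  from CondFalse.prems show ?case by (rule exec_cases(5)) (metis CondFalse.IH CondFalse.hyps(1) plus_1_eq_Suc add_Suc)+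
next
  case (WhileFalse b s p)
  from WhileFalse.prems show ?case by (rule exec_cases(6)) (simp_all add: WhileFalse.hyps)
next
  case (WhileTrue b s p t s' u s'')
  from WhileTrue.prems show ?case by (rule exec_cases(6)) (metis WhileTrue.IH WhileTrue.hyps(1) plus_1_eq_Suc add_Suc)+
qed

fun exp_consts :: "exp \<Rightarrow> nat set" where
  "exp_consts (Const k) = {k}"
| "exp_consts (Reg r) = {}"
| "exp_consts (Cell a e) = exp_consts e"
| "exp_consts (Inc e) = exp_consts e"
| "exp_consts (Sub e f) = exp_consts e \<union> exp_consts f"

fun prog_consts :: "prog \<Rightarrow> nat set" where
  "prog_consts Skip = {}"
| "prog_consts (Assign r e) = exp_consts e"
| "prog_consts (Store a i e) = exp_consts i \<union> exp_consts e"
| "prog_consts (Seq p q) = prog_consts p \<union> prog_consts q"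
| "prog_consts (Cond b p q) = prog_consts p \<union> prog_consts q"
| "prog_consts (While b p) = prog_consts p"

definition bounded_by :: "nat \<Rightarrow> state \<Rightarrow> bool" where
  "bounded_by M s \<longleftrightarrow> (\<forall>r. regs s r \<le> M) \<and> (\<forall>a i. arrs s a i \<le> M)"

lemma eval_exp_bounded:
  "bounded_by M s \<Longrightarrow> \<forall>k\<in>exp_consts e. k \<le> M \<Longrightarrow> eval_exp e s \<le> M + exp_cost e"
proof (induction e)
  case (Sub e f)
  then have "eval_exp e s \<le> M + exp_cost e" by simp
  then show ?case by simp
qed (auto simp: bounded_by_def le_SucI trans_le_add1)

lemma bounded_by_mono: "bounded_by M s \<Longrightarrow> M \<le> N \<Longrightarrow> bounded_by N s"
  unfolding bounded_by_def by (meson le_trans)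

lemma exec_bounded:
  "exec p s t s' \<Longrightarrow> bounded_by M s \<Longrightarrow> \<forall>k\<in>prog_consts p. k \<le> M \<Longrightarrow> bounded_by (M + t) s'"
proof (induction arbitrary: M rule: exec.induct)
  case (Skip s)
  then show ?case by (simp add: bounded_by_def le_SucI)
next
  case (Assign r e s)
  then have "eval_exp e s \<le> M + exp_cost e" by (simp add: eval_exp_bounded)
  with Assign show ?case by (simp add: bounded_by_def le_SucI trans_le_add1)
next
  case (Store a i e s)
  then have "eval_exp e s \<le> M + exp_cost e" by (simp add: eval_exp_bounded)
  with Store show ?case by (simp add: bounded_by_def le_SucI trans_le_add1)
next
  case (Seq p s t s' q u s'')
  from Seq.prems Seq.IH(1)[of M] Seq.IH(2)[of "M + t"] show ?case
    by (simp add: add.assoc trans_le_add1)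
next
  case (CondTrue b s p t s' q)
  from CondTrue.prems CondTrue.IH[of M] have "bounded_by (M + t) s'" by simp
  then show ?case by (rule bounded_by_mono) simp
next
  case (CondFalse b s q t s' p)
  from CondFalse.prems CondFalse.IH[of M] have "bounded_by (M + t) s'" by simp
  then show ?case by (rule bounded_by_mono) simp
next
  case (WhileFalse b s p)
  from WhileFalse.prems(1) show ?case by (rule bounded_by_mono) simp
next
  case (WhileTrue b s p t s' u s'')
  from WhileTrue.prems WhileTrue.IH(1)[of M] WhileTrue.IH(2)[of "M + t"]
  have "bounded_by (M + t + u) s''" by (simp add: trans_le_add1)
  then show ?case by (rule bounded_by_mono) simp
qed


section \<open>Input and output\<close>

(* nbs ! u lists the neighbours of u, in an arbitrary order. *)
definition adjacency_lists :: "nat \<Rightarrow> nat set set \<Rightarrow> nat list list \<Rightarrow> bool" where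
  "adjacency_lists n E nbs \<longleftrightarrow> length nbs = n \<and>
     (\<forall>u<n. distinct (nbs ! u) \<and> set (nbs ! u) = {v. {u, v} \<in> E})"

(* Register 0 holds n.  Array 1 is the concatenation of the adjacency lists, and the list of
   vertex u occupies its cells from (array 0)[u] up to, but excluding, (array 0)[u + 1].
   Array 2 is the indicator vector of S.  Everything else is zero. *)
definition input_state :: "nat \<Rightarrow> nat list list \<Rightarrow> nat set \<Rightarrow> state" where
  "input_state n nbs S = \<lparr>
     regs = (\<lambda>_. 0)(0 := n),
     arrs = (\<lambda>_ _. 0)
       (0 := (\<lambda>u. if u \<le> n then length (concat (take u nbs)) else 0),
        1 := (\<lambda>i. if i < length (concat nbs) then concat nbs ! i else 0),
        2 := (\<lambda>v. if v \<in> S then 1 else 0))\<rparr>"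

(* The results are read off array 3.  Finite distances in a graph with n vertices are
   smaller than n, so larger entries are available to represent \<infinity>. *)
definition estimate :: "nat \<Rightarrow> state \<Rightarrow> nat \<Rightarrow> enat" where
  "estimate n s v = (if arrs s 3 v < n then enat (arrs s 3 v) else \<infinity>)"

end

(* Every path from S to T passes through the boundary B. Run a breadth-first search from every
   b in B, and let a(v) be the distance of v from B, r the largest distance of a target from B,
   and e(b) the largest distance of a target from b. Then a(v) + r, max_b d(v,b) - 1 and
   max_b (e(b) - d(v,b)) are lower bounds for the eccentricity K of v, and they are at least
   a(v) + r, K - r - 1 and K - 2 a(v), respectively; by the average with weights 2, 2, 1 their
   maximum is at least (3 K - 2) / 5. *)
theory Submission
  imports Defs
begin

section \<open>Execution with a time budget\<close>

text \<open>The weights 2, 2, 1 are the ones for which \<open>a(v)\<close> and \<open>r\<close>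
  cancel: \<open>2 * (a(v) + r) + 2 * (K - r - 1) + (K - 2 * a(v)) = 3 * K - 2\<close>. For fixed
  \<open>v\<close>, the ingredients of the estimate are extrema over \<open>b\<close> of quantities
  known after the search from \<open>b\<close>. They are therefore folded into three arrays search
  by search, with work linear in \<open>n\<close> per boundary vertex besides the search itself; no
  table of distances is kept. Graphs may be disconnected. An infinite distance is represented by
  \<open>n + 1\<close>, and the output threshold for infinity is \<open>n\<close>, so that even
  \<open>max_boundary v - 1\<close> is still read as infinite when some boundary vertex is out of
  reach. Since running times are exact numbers, program correctness and cost are proved together: a
  specification carries a budget, and a linear bound for the search needs an amortised potential,
  namely the cost still reserved for the vertices that have not been expanded.\<close>

text \<open>A total-correctness precondition with time credits: the postcondition receives the
  unspent budget, so the second half of a sequence simply runs on what the first half left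
  over.\<close>

definition run :: "prog \<Rightarrow> state \<Rightarrow> nat \<Rightarrow> (state \<Rightarrow> nat \<Rightarrow> bool) \<Rightarrow> bool" where
  "run p s t Q \<longleftrightarrow> (\<exists>u s'. exec p s u s' \<and> u \<le> t \<and> Q s' (t - u))"

text \<open>Determinism makes any one known execution decisive for the existential in
  \<open>run\<close>. This turns the rules for basic commands into equations, and the simplifier can
  execute straight-line code symbolically.\<close>

lemma run_exec: "exec p s u s' \<Longrightarrow> run p s t Q \<longleftrightarrow> u \<le> t \<and> Q s' (t - u)"
  unfolding run_def by (metis exec_deterministic)

lemma run_Skip [simp]: "run Skip s t Q \<longleftrightarrow> 1 \<le> t \<and> Q s (t - 1)"
  by (rule run_exec[OF exec.Skip])

lemma run_Assign [simp]:
  "run (Assign r e) s t Q \<longleftrightarrow> 1 + exp_cost e \<le> t \<and>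
     Q (s\<lparr>regs := (regs s)(r := eval_exp e s)\<rparr>) (t - (1 + exp_cost e))"
  by (rule run_exec[OF exec.Assign])

lemma run_Store [simp]:
  "run (Store a i e) s t Q \<longleftrightarrow> 1 + exp_cost i + exp_cost e \<le> t \<and>
     Q (s\<lparr>arrs := (arrs s)(a := (arrs s a)(eval_exp i s := eval_exp e s))\<rparr>)
       (t - (1 + exp_cost i + exp_cost e))"
  by (rule run_exec[OF exec.Store])

lemma run_Seq [simp]: "run (Seq p q) s t Q \<longleftrightarrow> run p s t (\<lambda>s' t'. run q s' t' Q)"
proof
  assume "run (Seq p q) s t Q"
  then obtain u s'' where e: "exec (Seq p q) s u s''" and u: "u \<le> t" "Q s'' (t - u)"
    unfolding run_def by blast
  from e obtain u1 s' u2 where "exec p s u1 s'" "exec q s' u2 s''" "u = u1 + u2"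
    by (blast elim: exec_cases)
  with u have "u1 \<le> t \<and> u2 \<le> t - u1 \<and> Q s'' (t - u1 - u2)" by auto
  with \<open>exec p s u1 s'\<close> \<open>exec q s' u2 s''\<close> show "run p s t (\<lambda>s' t'. run q s' t' Q)"
    unfolding run_def by blast
next
  assume "run p s t (\<lambda>s' t'. run q s' t' Q)"
  then obtain u1 s' u2 s'' where "exec p s u1 s'" "u1 \<le> t" "exec q s' u2 s''" "u2 \<le> t - u1"
    "Q s'' (t - u1 - u2)"
    unfolding run_def by blast
  then have "exec (Seq p q) s (u1 + u2) s'' \<and> u1 + u2 \<le> t \<and> Q s'' (t - (u1 + u2))"
    by (auto intro: exec.Seq)
  then show "run (Seq p q) s t Q" unfolding run_def by blast
qed

lemma run_Cond [simp]:
  "run (Cond b p q) s t Q \<longleftrightarrow> 1 + test_cost b \<le> t \<and>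
     (if eval_test b s then run p s (t - (1 + test_cost b)) Q
      else run q s (t - (1 + test_cost b)) Q)"
  (is "_ \<longleftrightarrow> ?c \<le> t \<and> ?rhs")
proof
  assume "run (Cond b p q) s t Q"
  then obtain u s' where e: "exec (Cond b p q) s u s'" and u: "u \<le> t" "Q s' (t - u)"
    unfolding run_def by blast
  then obtain v where v: "u = ?c + v" "if eval_test b s then exec p s v s' else exec q s v s'"
    by (auto elim: exec_cases)
  with u have "?c \<le> t \<and> v \<le> t - ?c \<and> Q s' (t - ?c - v)" by simp
  with v(2) show "?c \<le> t \<and> ?rhs" unfolding run_def by (metis (full_types))
next
  assume a: "?c \<le> t \<and> ?rhs"
  then obtain v s' where v: "v \<le> t - ?c" "Q s' (t - ?c - v)"
    "if eval_test b s then exec p s v s' else exec q s v s'"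
    unfolding run_def by (cases "eval_test b s") auto
  then have "exec (Cond b p q) s (?c + v) s'"
    by (cases "eval_test b s") (auto intro: exec.CondTrue[simplified] exec.CondFalse[simplified])
  moreover have "?c + v \<le> t" "Q s' (t - (?c + v))" using a v by auto
  ultimately show "run (Cond b p q) s t Q" unfolding run_def by blast
qed

lemma run_mono:
  "run p s t Q \<Longrightarrow> (\<And>s' t'. Q s' t' \<Longrightarrow> Q' s' t') \<Longrightarrow> run p s t Q'"
  unfolding run_def by blast

text \<open>The interface between specifications and callers: a subprogram is specified for its own
  budget \<open>c\<close> without reference to the remainder, and a caller with budget
  \<open>t\<close> may rely on at least \<open>t - c\<close> being left.\<close>

lemma run_budget:
  assumes "run p s c (\<lambda>s' _. Q s')" "c \<le> t"
    and "\<And>s' t'. Q s' \<Longrightarrow> t - c \<le> t' \<Longrightarrow> Q' s' t'"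
  shows "run p s t Q'"
proof -
  from assms(1) obtain u s' where "exec p s u s'" "u \<le> c" "Q s'" unfolding run_def by blast
  then show ?thesis unfolding run_def using assms(2,3)
    by (intro exI[of _ u] exI[of _ s']) auto
qed

text \<open>Every iteration spends at least one unit of the budget, so the budget is also a
  termination measure.\<close>

lemma run_While:
  assumes step: "\<And>s t. I s t \<Longrightarrow> 1 + test_cost b \<le> t \<and>
      (if eval_test b s then run p s (t - (1 + test_cost b)) I else Q s (t - (1 + test_cost b)))"
    and "I s t"
  shows "run (While b p) s t Q"
  using \<open>I s t\<close>
proof (induction t arbitrary: s rule: less_induct)
  case (less t)
  let ?c = "1 + test_cost b"
  from step[OF less.prems] have c: "?c \<le> t" by simp
  show ?case
  proof (cases "eval_test b s")
    case False
    then have "exec (While b p) s ?c s" by (rule exec.WhileFalse)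
    with step[OF less.prems] False show ?thesis unfolding run_def by auto
  next
    case True
    with step[OF less.prems] have "run p s (t - ?c) I" by simp
    then obtain u s' where u: "exec p s u s'" "u \<le> t - ?c" "I s' (t - ?c - u)"
      unfolding run_def by blast
    have "t - ?c - u < t" using c by simp
    from less.IH[OF this u(3)] obtain w s'' where w: "exec (While b p) s' w s''"
      "w \<le> t - ?c - u" "Q s'' (t - ?c - u - w)"
      unfolding run_def by blast
    have "exec (While b p) s (?c + u + w) s''"
      using exec.WhileTrue[OF True u(1) w(1)] by simp
    moreover have "?c + u + w \<le> t" "Q s'' (t - (?c + u + w))" using c u(2) w(2,3) by auto
    ultimately show ?thesis unfolding run_def by blast
  qed
qed

definition for_loop :: "nat \<Rightarrow> exp \<Rightarrow> exp \<Rightarrow> prog \<Rightarrow> prog" where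
  "for_loop r l h p =
     Seq (Assign r l) (While (Less (Reg r) h) (Seq p (Assign r (Inc (Reg r)))))"

text \<open>The body cost \<open>c k\<close> may vary with the counter. This is what allows costs
  proportional to degrees, and costs incurred only at boundary vertices, to be summed exactly. The
  invariant is required of the state in which the counter has already been advanced.\<close>

lemma run_for_loop:
  assumes body: "\<And>k s. lo \<le> k \<Longrightarrow> k < hi \<Longrightarrow> I k s \<Longrightarrow> regs s r = k \<Longrightarrow>
      run p s (c k) (\<lambda>s' _. regs s' r = k \<and> I (Suc k) (s'\<lparr>regs := (regs s')(r := Suc k)\<rparr>))"
    and h: "\<And>k s. I k s \<Longrightarrow> eval_exp h s = hi"
    and l: "eval_exp l s = lo" "lo \<le> hi"
    and init: "I lo (s\<lparr>regs := (regs s)(r := lo)\<rparr>)"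
    and t: "(\<Sum>k=lo..<hi. c k + (exp_cost h + 6)) + (exp_cost l + exp_cost h + 4) \<le> t"
  shows "run (for_loop r l h p) s t (\<lambda>s' _. I hi s')"
proof -
  \<comment> \<open>The loop test costs \<open>exp_cost h + 3\<close> and the increment of the
    counter costs 3.\<close>
  let ?K = "exp_cost h + 6"
  let ?J = "\<lambda>s t. \<exists>k. regs s r = k \<and> lo \<le> k \<and> k \<le> hi \<and> I k s \<and>
     (\<Sum>k=k..<hi. c k + ?K) + (exp_cost h + 3) \<le> t"
  have "run (While (Less (Reg r) h) (Seq p (Assign r (Inc (Reg r)))))
      (s\<lparr>regs := (regs s)(r := lo)\<rparr>) (t - (1 + exp_cost l)) (\<lambda>s' _. I hi s')"
  proof (rule run_While[where I = ?J])
    fix s t assume "?J s t"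
    then obtain k where k: "regs s r = k" "lo \<le> k" "k \<le> hi" "I k s"
      "(\<Sum>k=k..<hi. c k + ?K) + (exp_cost h + 3) \<le> t" by blast
    have hv: "eval_exp h s = hi" by (rule h[OF k(4)])
    show "1 + test_cost (Less (Reg r) h) \<le> t \<and>
      (if eval_test (Less (Reg r) h) s
       then run (Seq p (Assign r (Inc (Reg r)))) s (t - (1 + test_cost (Less (Reg r) h))) ?J
       else I hi s)"
    proof (cases "k < hi")
      case False
      with k hv show ?thesis by auto
    next
      case True
      have sum: "(\<Sum>k=k..<hi. c k + ?K) = c k + ?K + (\<Sum>k=Suc k..<hi. c k + ?K)"
        using True by (rule sum.atLeast_Suc_lessThan)
      have "run (Seq p (Assign r (Inc (Reg r)))) s (t - (1 + test_cost (Less (Reg r) h))) ?J"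
        unfolding run_Seq
        by (rule run_budget[OF body[OF k(2) True k(4,1)]])
          (use k True sum in \<open>auto\<close>)
      with k hv True sum show ?thesis by simp
    qed
  next
    show "?J (s\<lparr>regs := (regs s)(r := lo)\<rparr>) (t - (1 + exp_cost l))"
      using t l init by auto
  qed
  then show ?thesis using t l by (simp add: for_loop_def)
qed

lemma run_for_loop_const:
  assumes "\<And>k s. k < hi \<Longrightarrow> I k s \<Longrightarrow> regs s r = k \<Longrightarrow>
      run p s c (\<lambda>s' _. regs s' r = k \<and> I (Suc k) (s'\<lparr>regs := (regs s')(r := Suc k)\<rparr>))"
    and "\<And>k s. I k s \<Longrightarrow> eval_exp h s = hi"
    and "I 0 (s\<lparr>regs := (regs s)(r := 0)\<rparr>)"
    and "hi * (c + exp_cost h + 6) + (exp_cost h + 5) \<le> t"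
  shows "run (for_loop r (Const 0) h p) s t (\<lambda>s' _. I hi s')"
  by (rule run_for_loop[where lo = 0 and c = "\<lambda>_. c"]) (use assms in \<open>auto simp: algebra_simps\<close>)

section \<open>Frame conditions: which registers and arrays a program may change\<close>

definition agree :: "nat set \<Rightarrow> nat set \<Rightarrow> state \<Rightarrow> state \<Rightarrow> bool" where
  "agree R A s s' \<longleftrightarrow>
     (\<forall>r. r \<notin> R \<longrightarrow> regs s' r = regs s r) \<and> (\<forall>a. a \<notin> A \<longrightarrow> arrs s' a = arrs s a)"

lemma agree_reg: "agree R A s s' \<Longrightarrow> r \<notin> R \<Longrightarrow> regs s' r = regs s r"
  by (simp add: agree_def)

lemma agree_arr: "agree R A s s' \<Longrightarrow> a \<notin> A \<Longrightarrow> arrs s' a = arrs s a"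
  by (simp add: agree_def)

lemma agree_trans:
  "agree R A s s' \<Longrightarrow> agree R' A' s' s'' \<Longrightarrow> R \<subseteq> R'' \<Longrightarrow> R' \<subseteq> R'' \<Longrightarrow> A \<subseteq> A'' \<Longrightarrow> A' \<subseteq> A'' \<Longrightarrow>
   agree R'' A'' s s''"
  unfolding agree_def by (metis subset_iff)

section \<open>Distances\<close>

text \<open>An infimum of extended naturals is attained unless the set is empty, and then it is
  infinite. The facts on distances below rest on this passage to walks.\<close>

lemma gdist_le_iff: "gdist E u v \<le> enat k \<longleftrightarrow> (\<exists>j\<le>k. (u, v) \<in> adj_rel E ^^ j)"
proof
  assume le: "gdist E u v \<le> enat k"
  have ne: "enat ` {k. (u, v) \<in> adj_rel E ^^ k} \<noteq> {}"
  proof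
    assume e: "enat ` {k. (u, v) \<in> adj_rel E ^^ k} = {}"
    show False using le unfolding gdist_def e by (simp add: Inf_enat_def)
  qed
  then have "gdist E u v \<in> enat ` {k. (u, v) \<in> adj_rel E ^^ k}"
    unfolding gdist_def Inf_enat_def by (metis (mono_tags, lifting) LeastI_ex ex_in_conv)
  with le show "\<exists>j\<le>k. (u, v) \<in> adj_rel E ^^ j" by auto
next
  assume "\<exists>j\<le>k. (u, v) \<in> adj_rel E ^^ j"
  then show "gdist E u v \<le> enat k"
    unfolding gdist_def by (meson INF_lower2 enat_ord_simps(1) mem_Collect_eq)
qed

lemma gdist_eq_enatD:
  assumes "gdist E u v = enat k"
  shows "(u, v) \<in> adj_rel E ^^ k"
proof -
  from assms obtain j where j: "j \<le> k" "(u, v) \<in> adj_rel E ^^ j"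
    using gdist_le_iff[of E u v k] by auto
  then have "gdist E u v \<le> enat j" by (auto simp: gdist_le_iff)
  with assms j show ?thesis by simp
qed

lemma gdist_le_relpow: "(u, v) \<in> adj_rel E ^^ k \<Longrightarrow> gdist E u v \<le> enat k"
  by (auto simp: gdist_le_iff)

lemma gdist_triangle: "gdist E u w \<le> gdist E u v + gdist E v w"
proof (cases "gdist E u v"; cases "gdist E v w")
  fix i j assume "gdist E u v = enat i" "gdist E v w = enat j"
  then have "(u, w) \<in> adj_rel E ^^ (i + j)"
    by (auto simp: relpow_add dest!: gdist_eq_enatD)
  from gdist_le_relpow[OF this] show ?thesis using \<open>gdist E u v = enat i\<close> \<open>gdist E v w = enat j\<close>
    by simp
qed simp_all

lemma relpow_adj_rel_sym: "(u, v) \<in> adj_rel E ^^ k \<Longrightarrow> (v, u) \<in> adj_rel E ^^ k"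
proof (induction k arbitrary: v)
  case (Suc k)
  then obtain w where w: "(u, w) \<in> adj_rel E ^^ k" "(w, v) \<in> adj_rel E" by auto
  from w(2) have "(v, w) \<in> adj_rel E" by (simp add: adj_rel_def insert_commute)
  from relpow_Suc_I2[OF this Suc.IH[OF w(1)]] show ?case .
qed simp

lemma gdist_sym: "gdist E u v = gdist E v u"
  unfolding gdist_def by (metis relpow_adj_rel_sym)

lemma gdist_self [simp]: "gdist E v v = 0"
  using gdist_le_relpow[where u = v and v = v and k = 0 and E = E] by (simp flip: zero_enat_def)

lemma gdist_edge: "{u, v} \<in> E \<Longrightarrow> gdist E u v \<le> 1"
  using gdist_le_relpow[where u = u and v = v and k = 1 and E = E] by (simp add: adj_rel_def one_enat_def)

text \<open>On a shortest walk every distance from \<open>0\<close> to \<open>k\<close> occurs at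
  some vertex, so \<open>k + 1\<close> different values are taken on \<open>n\<close>
  vertices.\<close>

lemma gdist_less_vertices:
  assumes g: "simple_graph {..<n} E" "u < n" and d: "gdist E u v = enat k"
  shows "k < n"
proof -
  \<comment> \<open>Downward induction from \<open>k\<close>: the predecessor of a vertex at
    distance \<open>Suc j\<close> on a shortest walk is reached in \<open>j\<close> steps, and by
    the triangle inequality it cannot be closer.\<close>
  have sub: "(\<exists>w<n. gdist E u w = enat j)" if "j \<le> k" for j
    using that
  proof (induction j rule: inc_induct)
    case base
    have "v < n"
    proof (cases k)
      case 0
      with gdist_eq_enatD[OF d] \<open>u < n\<close> show ?thesis by simp
    next
      case (Suc j)
      with gdist_eq_enatD[OF d] obtain w where "{w, v} \<in> E" by (auto simp: adj_rel_def)
      with g(1) show ?thesis by (auto simp: simple_graph_def doubleton_eq_iff)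
    qed
    with d show ?case by blast
  next
    case (step j)
    then obtain w where w: "w < n" "gdist E u w = enat (Suc j)" by blast
    from gdist_eq_enatD[OF w(2)] obtain x where x: "(u, x) \<in> adj_rel E ^^ j" "{x, w} \<in> E"
      by (auto simp: adj_rel_def)
    from x(2) g(1) have "x < n" by (auto simp: simple_graph_def doubleton_eq_iff)
    have "enat (Suc j) \<le> gdist E u x + 1"
      using gdist_triangle[of E u w x] gdist_edge[OF x(2)] w(2)
      by (metis add_left_mono order_trans)
    with gdist_le_relpow[OF x(1)] have "gdist E u x = enat j"
      by (cases "gdist E u x") (auto simp: one_enat_def)
    with \<open>x < n\<close> show ?case by blast
  qed
  then have "{..k} \<subseteq> (\<lambda>w. the_enat (gdist E u w)) ` {..<n}"
    by (force simp: image_iff Bex_def)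
  from card_mono[OF _ this] have "Suc k \<le> card ((\<lambda>w. the_enat (gdist E u w)) ` {..<n})" by simp
  also have "\<dots> \<le> n" using card_image_le[of "{..<n}"] by simp
  finally show ?thesis by simp
qed

text \<open>Finite distances are below \<open>n\<close>, so \<open>n\<close> would already be free
  to represent infinity. \<open>Suc n\<close> is taken because the estimate subtracts 1 from a
  maximum of distances and the result must not drop below \<open>n\<close>.\<close>

definition capped_dist :: "nat \<Rightarrow> nat set set \<Rightarrow> nat \<Rightarrow> nat \<Rightarrow> nat" where
  "capped_dist n E u v = (case gdist E u v of enat k \<Rightarrow> k | \<infinity> \<Rightarrow> Suc n)"


section \<open>Maxima and minima with a value for the empty set\<close>

definition max_over :: "(nat \<Rightarrow> nat) \<Rightarrow> nat set \<Rightarrow> nat" where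
  "max_over f X = Max (insert 0 (f ` X))"

definition min_over :: "nat \<Rightarrow> (nat \<Rightarrow> nat) \<Rightarrow> nat set \<Rightarrow> nat" where
  "min_over c f X = Min (insert c (f ` X))"

lemma max_over_ge: "finite X \<Longrightarrow> x \<in> X \<Longrightarrow> f x \<le> max_over f X"
  by (simp add: max_over_def)

lemma max_over_le_iff: "finite X \<Longrightarrow> max_over f X \<le> c \<longleftrightarrow> (\<forall>x\<in>X. f x \<le> c)"
  by (simp add: max_over_def)

lemma min_over_le: "finite X \<Longrightarrow> x \<in> X \<Longrightarrow> min_over c f X \<le> f x"
  by (simp add: min_over_def)

lemma min_over_attained:
  "finite X \<Longrightarrow> min_over c f X < c \<Longrightarrow> \<exists>x\<in>X. f x = min_over c f X"
  using Min_in[of "insert c (f ` X)"] by (auto simp: min_over_def)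

lemma over_empty [simp]: "max_over f {} = 0" "min_over c f {} = c"
  by (simp_all add: max_over_def min_over_def)

lemma Int_lessThan_Suc:
  "X \<inter> {..<Suc k} = (if k \<in> X then insert k (X \<inter> {..<k}) else X \<inter> {..<k})"
  by (auto simp: less_Suc_eq)

text \<open>This and \<open>min_over_Suc\<close> describe one iteration of a loop that folds over
  \<open>X\<close>; the values on the empty set are those with which the arrays and registers are
  initialised.\<close>

lemma max_over_Suc:
  "max_over f (X \<inter> {..<Suc k}) =
     (if k \<in> X then max (max_over f (X \<inter> {..<k})) (f k) else max_over f (X \<inter> {..<k}))"
  by (simp add: max_over_def Int_lessThan_Suc insert_commute[of 0] max.commute)

lemma min_over_Suc:
  "min_over c f (X \<inter> {..<Suc k}) =
     (if k \<in> X then min (min_over c f (X \<inter> {..<k})) (f k) else min_over c f (X \<inter> {..<k}))"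
  by (simp add: min_over_def Int_lessThan_Suc insert_commute[of c] min.commute)


section \<open>Approximating eccentricities by distances from the boundary\<close>

text \<open>Which border is the smaller one is left open here: the quality of the estimate is the
  same for both, and the choice enters only through the running time.\<close>

locale partitioned_graph =
  fixes n :: nat and E :: "nat set set" and S T B :: "nat set"
  assumes graph: "simple_graph {..<n} E"
    and S: "S \<subseteq> {..<n}" and T: "T = {..<n} - S" and T_ne: "T \<noteq> {}"
    and B: "B = border E S T \<or> B = border E T S"
begin

abbreviation D :: "nat \<Rightarrow> nat \<Rightarrow> nat" where "D \<equiv> capped_dist n E"

text \<open>\<open>dist_boundary\<close>, \<open>far_target\<close> and \<open>radius\<close> are
  the \<open>a\<close>, \<open>e\<close> and \<open>r\<close> of the overview. If \<open>B\<close>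
  is empty the minimum is \<open>Suc n\<close>, so every estimate is then read as infinite.\<close>

definition dist_boundary :: "nat \<Rightarrow> nat" where
  "dist_boundary v = min_over (Suc n) (\<lambda>b. D b v) B"

definition max_boundary :: "nat \<Rightarrow> nat" where
  "max_boundary v = max_over (\<lambda>b. D b v) B"

definition far_target :: "nat \<Rightarrow> nat" where
  "far_target b = max_over (D b) T"

definition slack_boundary :: "nat \<Rightarrow> nat" where
  "slack_boundary v = max_over (\<lambda>b. far_target b - D b v) B"

definition radius :: nat where
  "radius = max_over dist_boundary T"

definition est :: "nat \<Rightarrow> nat" where
  "est v = max (max (slack_boundary v) (dist_boundary v + radius)) (max_boundary v - 1)"

lemma B_sub: "B \<subseteq> {..<n}"
  using B S T by (auto simp: border_def)

lemma fin [simp]: "finite B" "finite T" "finite S"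
  using B_sub S T finite_subset[of _ "{..<n}"] by auto

lemma edge_bound: "{u, v} \<in> E \<Longrightarrow> u < n \<and> v < n"
  using graph by (auto simp: simple_graph_def doubleton_eq_iff)

lemma D_le: "u < n \<Longrightarrow> D u v \<le> Suc n"
  using gdist_less_vertices[OF graph, of u v]
  by (cases "gdist E u v") (auto simp: capped_dist_def less_imp_le)

text \<open>The first edge of the walk that leads from \<open>S\<close> to \<open>T\<close> has its
  tail in \<open>border E S T\<close> and its head in \<open>border E T S\<close>, so it meets
  \<open>B\<close> whichever border was chosen. The lengths of the two parts add up exactly, which
  is what a shortest walk needs.\<close>

lemma walk_crosses_boundary:
  assumes "(v, u) \<in> adj_rel E ^^ k" "v \<in> S" "u \<in> T"
  shows "\<exists>b\<in>B. \<exists>i j. i + j = k \<and> (v, b) \<in> adj_rel E ^^ i \<and> (b, u) \<in> adj_rel E ^^ j"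
  using assms
proof (induction k arbitrary: v)
  case 0
  then show ?case using T by auto
next
  case (Suc k)
  then obtain w where w: "(v, w) \<in> adj_rel E" "(w, u) \<in> adj_rel E ^^ k"
    by (meson relpow_Suc_D2)
  have e: "{v, w} \<in> E" "{w, v} \<in> E" using w(1) by (auto simp: adj_rel_def insert_commute)
  show ?case
  proof (cases "w \<in> S")
    case True
    from Suc.IH[OF w(2) this Suc.prems(3)] obtain b i j where
      b: "b \<in> B" "i + j = k" "(w, b) \<in> adj_rel E ^^ i" "(b, u) \<in> adj_rel E ^^ j" by blast
    have "(v, b) \<in> adj_rel E ^^ Suc i" by (rule relpow_Suc_I2[OF w(1) b(3)])
    with b show ?thesis by (intro bexI[of _ b] exI[of _ "Suc i"] exI[of _ j]) auto
  next
    case False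
    then have "w \<in> T" using edge_bound[OF e(1)] T by auto
    from B show ?thesis
    proof
      assume "B = border E S T"
      then have "v \<in> B" using e Suc.prems(2) \<open>w \<in> T\<close> by (auto simp: border_def)
      with Suc.prems(1) show ?thesis
        by (intro bexI[of _ v] exI[of _ "0::nat"] exI[of _ "Suc k"]) auto
    next
      assume "B = border E T S"
      then have "w \<in> B" using e Suc.prems(2) \<open>w \<in> T\<close> by (auto simp: border_def)
      with w show ?thesis
        by (intro bexI[of _ w] exI[of _ "1::nat"] exI[of _ k]) auto
    qed
  qed
qed

lemma D_sym: "D u v = D v u"
  by (simp add: capped_dist_def gdist_sym)

text \<open>The bound on \<open>k\<close> excludes the capped value \<open>Suc n\<close>.\<close>

lemma D_le_iff: "k \<le> n \<Longrightarrow> D u v \<le> k \<longleftrightarrow> gdist E u v \<le> enat k"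
  by (cases "gdist E u v") (auto simp: capped_dist_def)

lemma D_leI: "gdist E u v \<le> enat k \<Longrightarrow> D u v \<le> k"
  by (cases "gdist E u v") (auto simp: capped_dist_def)

lemma gdist_eq_D: "D u v \<le> n \<Longrightarrow> gdist E u v = enat (D u v)"
  by (cases "gdist E u v") (auto simp: capped_dist_def)

lemma D_triangle:
  assumes "u < n" "D u v \<le> n" "D v w \<le> n"
  shows "D u w \<le> D u v + D v w"
proof -
  have "gdist E u w \<le> enat (D u v + D v w)"
    using gdist_triangle[of E u w v] gdist_eq_D[OF assms(2)] gdist_eq_D[OF assms(3)] by simp
  then show ?thesis by (cases "gdist E u w") (auto simp: capped_dist_def)
qed

lemma dist_boundary_le: "b \<in> B \<Longrightarrow> dist_boundary v \<le> D b v"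
  unfolding dist_boundary_def by (rule min_over_le) simp_all

lemma dist_boundary_attained: "dist_boundary v \<le> n \<Longrightarrow> \<exists>b\<in>B. D b v = dist_boundary v"
  unfolding dist_boundary_def by (rule min_over_attained) simp_all

lemma D_le_max_boundary: "b \<in> B \<Longrightarrow> D b v \<le> max_boundary v"
  unfolding max_boundary_def by (rule max_over_ge) simp_all

lemma far_target_ge: "u \<in> T \<Longrightarrow> D b u \<le> far_target b"
  by (simp add: far_target_def max_over_ge)

lemma slack_boundary_ge: "b \<in> B \<Longrightarrow> far_target b - D b v \<le> slack_boundary v"
  unfolding slack_boundary_def by (rule max_over_ge) simp_all

lemma radius_ge: "u \<in> T \<Longrightarrow> dist_boundary u \<le> radius"
  by (simp add: radius_def max_over_ge)

lemma ecc_ge: "u \<in> T \<Longrightarrow> gdist E v u \<le> ecc_to E T v"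
  by (simp add: ecc_to_def)

lemma ecc_attained: "\<exists>u\<in>T. gdist E v u = ecc_to E T v"
  using Max_in[of "gdist E v ` T"] T_ne unfolding ecc_to_def by (metis finite_imageI fin(2) image_is_empty imageE)

lemma ecc_less: "v < n \<Longrightarrow> ecc_to E T v = enat k \<Longrightarrow> k < n"
  using ecc_attained[of v] gdist_less_vertices[OF graph] by metis

text \<open>Each of the three terms of \<open>est\<close> is compared with a finite eccentricity
  \<open>K\<close> separately; as \<open>K < n\<close>, all targets have uncapped distances from
  \<open>v\<close>.\<close>

lemma est_le_ecc:
  assumes v: "v \<in> S"
  shows "enat (est v) \<le> ecc_to E T v"
proof (cases "ecc_to E T v")
  case (enat K)
  have vn: "v < n" using v S by auto
  have K: "K < n" using ecc_less[OF vn enat] .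
  have Dv: "D v u \<le> K" if "u \<in> T" for u
    using ecc_ge[OF that, of v] enat K by (simp add: D_le_iff)
  \<comment> \<open>For a target \<open>u\<close> realising \<open>radius\<close>, a shortest walk
    from \<open>v\<close> to \<open>u\<close> meets \<open>B\<close> in some \<open>b\<close>; its
    two parts are at least as long as the distances of \<open>v\<close> and \<open>u\<close> from
    \<open>B\<close>. The inequality for \<open>u\<close> also covers the 0 inserted by
    \<open>max_over\<close>.\<close>
  have "dist_boundary v + radius \<le> K"
  proof -
    have "radius \<in> insert 0 (dist_boundary ` T)" unfolding radius_def max_over_def by (rule Max_in) simp_all
    then obtain u where u: "u \<in> T" "radius \<le> dist_boundary u" using T_ne by force
    have "gdist E v u = enat (D v u)" using Dv[OF u(1)] K by (intro gdist_eq_D) simp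
    from walk_crosses_boundary[OF gdist_eq_enatD[OF this] v u(1)] obtain b i j where
      b: "b \<in> B" "i + j = D v u" "(v, b) \<in> adj_rel E ^^ i" "(b, u) \<in> adj_rel E ^^ j" by blast
    have "D v b \<le> i" "D b u \<le> j"
      using gdist_le_relpow[OF b(3)] gdist_le_relpow[OF b(4)] by (auto intro: D_leI)
    with dist_boundary_le[OF b(1), of v] dist_boundary_le[OF b(1), of u] b(2) Dv[OF u(1)] u(2)
    show ?thesis by (simp add: D_sym[of b v])
  qed
  \<comment> \<open>A boundary vertex lies in \<open>T\<close> or is adjacent to \<open>T\<close>,
    hence is at most one step beyond some target. This is the origin of the \<open>- 1\<close> in
    \<open>est\<close>.\<close>
  moreover have "max_boundary v \<le> Suc K"
  proof -
    have "D b v \<le> Suc K" if b: "b \<in> B" for b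
    proof -
      obtain u where u: "u \<in> T" "gdist E u b \<le> 1"
      proof (cases "b \<in> T")
        case True
        with that show ?thesis by simp
      next
        case False
        with b B obtain u where "u \<in> T" "{b, u} \<in> E" by (auto simp: border_def)
        then show ?thesis using that[of u] gdist_edge[of u b E] by (simp add: insert_commute)
      qed
      have "gdist E v b \<le> enat K + 1"
        using gdist_triangle[of E v b u] ecc_ge[OF u(1), of v] u(2) enat
        by (metis add_mono order_trans)
      then show ?thesis using K by (simp add: D_sym[of b v] D_le_iff one_enat_def)
    qed
    then show ?thesis by (simp add: max_boundary_def max_over_le_iff)
  qed
  moreover have "slack_boundary v \<le> K"
  proof -
    have "far_target b - D b v \<le> K" if b: "b \<in> B" for b
    proof -
      have bn: "b < n" using b B_sub by auto
      have "D b u \<le> K + D b v" if u: "u \<in> T" for u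
      \<comment> \<open>The triangle inequality through \<open>v\<close>; if \<open>b\<close> and
        \<open>v\<close> are not connected, \<open>D b v\<close> is already the largest possible
        value.\<close>
      proof (cases "D b v \<le> n")
        case True
        then show ?thesis using D_triangle[OF bn True, of u] Dv[OF u] K by simp
      next
        case False
        then show ?thesis using D_le[OF bn, of u] by simp
      qed
      then have "far_target b \<le> K + D b v" by (simp add: far_target_def max_over_le_iff)
      then show ?thesis by simp
    qed
    then show ?thesis by (simp add: slack_boundary_def max_over_le_iff)
  qed
  ultimately show ?thesis by (simp add: est_def enat)
qed simp

text \<open>If \<open>est v < n\<close>, then the term \<open>max_boundary v - 1\<close> shows that
  \<open>v\<close> reaches all of \<open>B\<close>, and the term with \<open>radius\<close> shows
  that every target is reached from some vertex of \<open>B\<close>. Together they connect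
  \<open>v\<close> to every target.\<close>

lemma est_infinite:
  assumes v: "v \<in> S" and inf: "ecc_to E T v = \<infinity>"
  shows "n \<le> est v"
proof (rule ccontr)
  assume "\<not> n \<le> est v"
  then have lt: "dist_boundary v + radius < n" "max_boundary v \<le> n" by (auto simp: est_def)
  obtain u where u: "u \<in> T" "gdist E v u = \<infinity>" using ecc_attained[of v] inf by auto
  from lt radius_ge[OF u(1)] have "dist_boundary u \<le> n" by simp
  with dist_boundary_attained obtain b where b: "b \<in> B" "D b u \<le> n" by metis
  have "D v b \<le> n" using D_le_max_boundary[OF b(1), of v] lt by (simp add: D_sym[of b v])
  with b have "gdist E v u \<le> enat (D v b + D b u)"
    using gdist_triangle[of E v u b] gdist_eq_D[of v b] gdist_eq_D[of b u] by simp
  with u show False by simp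
qed

text \<open>Let \<open>u\<close> be a farthest target. The detour through the boundary vertex
  \<open>b1\<close> nearest to \<open>v\<close> bounds \<open>K\<close> by
  \<open>slack_boundary v\<close> and \<open>dist_boundary v\<close>; the detour through the
  boundary vertex \<open>b2\<close> nearest to \<open>u\<close> bounds it by
  \<open>max_boundary v\<close> and \<open>radius\<close>.\<close>

lemma ecc_le_est:
  assumes v: "v \<in> S" and K: "ecc_to E T v = enat K"
  shows "3 * K \<le> 5 * est v + 2"
proof -
  have vn: "v < n" using v S by auto
  have Kn: "K < n" using ecc_less[OF vn K] .
  obtain u where u: "u \<in> T" "gdist E v u = enat K" using ecc_attained[of v] K by auto
  have DK: "D v u = K" using u(2) by (simp add: capped_dist_def)
  from walk_crosses_boundary[OF gdist_eq_enatD[OF u(2)] v u(1)] obtain b i j where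
    b: "b \<in> B" "i + j = K" "(v, b) \<in> adj_rel E ^^ i" "(b, u) \<in> adj_rel E ^^ j" by blast
  have "D v b \<le> i" "D b u \<le> j"
    using gdist_le_relpow[OF b(3)] gdist_le_relpow[OF b(4)] by (auto intro: D_leI)
  \<comment> \<open>A finite \<open>K\<close> makes \<open>B\<close> reachable from both
    \<open>v\<close> and \<open>u\<close>, so the nearest boundary vertices exist and are not
    artefacts of the cap.\<close>
  with dist_boundary_le[OF b(1), of v] dist_boundary_le[OF b(1), of u] b(2) Kn
  have near: "dist_boundary v \<le> n" "dist_boundary u \<le> n" by (auto simp: D_sym[of b v])
  from dist_boundary_attained[OF near(1)] obtain b1 where
    b1: "b1 \<in> B" "D b1 v = dist_boundary v" by blast
  from dist_boundary_attained[OF near(2)] obtain b2 where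
    b2: "b2 \<in> B" "D b2 u = dist_boundary u" by blast
  have "K \<le> dist_boundary v + D b1 u"
  proof (cases "D b1 u \<le> n")
    case True
    then show ?thesis using D_triangle[OF vn, of b1 u] b1 near(1) DK by (simp add: D_sym[of b1 v])
  next
    case False
    then show ?thesis using Kn by simp
  qed
  with far_target_ge[OF u(1), of b1] slack_boundary_ge[OF b1(1), of v] b1(2)
  have "K \<le> slack_boundary v + 2 * dist_boundary v" by simp
  moreover have "K \<le> D b2 v + dist_boundary u"
  proof (cases "D b2 v \<le> n")
    case True
    then show ?thesis using D_triangle[OF vn, of b2 u] b2 near(2) DK by (simp add: D_sym[of b2 v])
  next
    case False
    then show ?thesis using Kn by simp
  qed
  then have "K \<le> max_boundary v + radius"
    using D_le_max_boundary[OF b2(1), of v] radius_ge[OF u(1)] by simp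
  moreover have "slack_boundary v \<le> est v" "dist_boundary v + radius \<le> est v"
    "max_boundary v \<le> est v + 1"
    by (auto simp: est_def)
  \<comment> \<open>The first bound plus twice the second: \<open>3 * K\<close> is at most
    \<open>slack_boundary v + 2 * (dist_boundary v + radius) + 2 * max_boundary v\<close>, hence at
    most \<open>5 * est v + 2\<close>.\<close>
  ultimately show ?thesis by linarith
qed

text \<open>A finite eccentricity is below \<open>n\<close>, so \<open>est v\<close> is below
  \<open>n\<close> too and is read literally; for an infinite one \<open>est v\<close> reaches the
  threshold. The additive error obtained is 2/5, within the permitted 1.\<close>

theorem est_approximates:
  assumes v: "v \<in> S" and s: "arrs s 3 v = est v"
  shows "ereal (3/5) * ereal_of_enat (ecc_to E T v) - 1 \<le> ereal_of_enat (estimate n s v)"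
    and "estimate n s v \<le> ecc_to E T v"
proof -
  have vn: "v < n" using v S by auto
  show "estimate n s v \<le> ecc_to E T v"
  proof (cases "ecc_to E T v")
    case (enat K)
    with ecc_less[OF vn enat] est_le_ecc[OF v] show ?thesis by (auto simp: estimate_def s)
  qed simp
  show "ereal (3/5) * ereal_of_enat (ecc_to E T v) - 1 \<le> ereal_of_enat (estimate n s v)"
  proof (cases "ecc_to E T v")
    case (enat K)
    with ecc_le_est[OF v enat] show ?thesis
      by (auto simp: estimate_def s one_ereal_def field_simps)
  next
    case infinity
    with est_infinite[OF v] show ?thesis by (simp add: estimate_def s)
  qed
qed

end

section \<open>Breadth-first search\<close>

text \<open>Register 1 holds the vertex being expanded and register 2 a position in its adjacency
  list. A label above \<open>n\<close> means that the neighbour is undiscovered.\<close>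

definition bfs_scan :: prog where
  "bfs_scan =
     Cond (Less (Reg 0) (Cell 4 (Cell 1 (Reg 2))))
       (Seq (Store 4 (Cell 1 (Reg 2)) (Inc (Cell 4 (Reg 1))))
       (Seq (Store 5 (Reg 8) (Cell 1 (Reg 2)))
            (Assign 8 (Inc (Reg 8)))))
       Skip"

definition bfs_visit :: prog where
  "bfs_visit =
     Seq (Assign 1 (Cell 5 (Reg 7)))
    (Seq (for_loop 2 (Cell 0 (Reg 1)) (Cell 0 (Inc (Reg 1))) bfs_scan)
         (Assign 7 (Inc (Reg 7))))"

text \<open>The source is in register 6. Array 4 receives the distances, with \<open>n + 1\<close> for \<open>\<infinity>\<close>;
  array 5 is the queue, between the positions in registers 7 and 8.\<close>

definition bfs :: prog where
  "bfs =
     Seq (for_loop 9 (Const 0) (Reg 0) (Store 4 (Reg 9) (Inc (Reg 0))))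
    (Seq (Store 4 (Reg 6) (Const 0))
    (Seq (Store 5 (Const 0) (Reg 6))
    (Seq (Assign 7 (Const 0))
    (Seq (Assign 8 (Const 1))
         (While (Less (Reg 7) (Reg 8)) bfs_visit)))))"

locale encoded_graph = partitioned_graph +
  fixes nbs :: "nat list list"
  assumes nbs: "adjacency_lists n E nbs" and B_boundary: "B = boundary E S T"
begin

definition off :: "nat \<Rightarrow> nat" where "off u = length (concat (take u nbs))"

definition adj :: "nat \<Rightarrow> nat" where "adj i = concat nbs ! i"

definition deg :: "nat \<Rightarrow> nat" where "deg u = length (nbs ! u)"

text \<open>Register 0 and arrays 0 to 2 are never written, so this property survives every program
  through \<open>encodes_agree\<close>.\<close>

definition encodes :: "state \<Rightarrow> bool" where
  "encodes s \<longleftrightarrow> regs s 0 = n \<and> (\<forall>u\<le>n. arrs s 0 u = off u) \<and>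
     (\<forall>i<off n. arrs s 1 i = adj i) \<and> (\<forall>v. arrs s 2 v = (if v \<in> S then 1 else 0))"

lemma encodesD:
  assumes "encodes s"
  shows "regs s 0 = n" "u \<le> n \<Longrightarrow> arrs s 0 u = off u" "i < off n \<Longrightarrow> arrs s 1 i = adj i"
    "arrs s 2 v = (if v \<in> S then 1 else 0)"
  using assms by (auto simp: encodes_def)

lemma encodes_agree:
  "encodes s \<Longrightarrow> agree R A s s' \<Longrightarrow> 0 \<notin> R \<Longrightarrow> 0 \<notin> A \<Longrightarrow> 1 \<notin> A \<Longrightarrow> 2 \<notin> A \<Longrightarrow> encodes s'"
  by (simp add: encodes_def agree_def)

lemma length_nbs: "length nbs = n"
  using nbs by (simp add: adjacency_lists_def)

lemma off_Suc: "u < n \<Longrightarrow> off (Suc u) = off u + deg u"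
  by (simp add: off_def deg_def take_Suc_conv_app_nth length_nbs)

lemma off_0 [simp]: "off 0 = 0"
  by (simp add: off_def)

lemma sum_deg: "u \<le> n \<Longrightarrow> (\<Sum>v<u. deg v) = off u"
  by (induction u) (simp_all add: off_Suc)

lemma off_mono: "u \<le> v \<Longrightarrow> v \<le> n \<Longrightarrow> off u \<le> off v"
  by (induction v rule: dec_induct) (simp_all add: off_Suc)

lemma adj_image:
  assumes "u < n"
  shows "adj ` {off u..<off (Suc u)} = {v. {u, v} \<in> E}"
proof -
  have "concat nbs = concat (take u nbs) @ nbs ! u @ concat (drop (Suc u) nbs)"
    using id_take_nth_drop[of u nbs] assms length_nbs by (metis concat.simps(2) concat_append)
  then have nth: "adj (off u + j) = nbs ! u ! j" if "j < deg u" for j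
    using that by (simp add: adj_def off_def deg_def nth_append)
  have "{off u..<off (Suc u)} = (+) (off u) ` {0..<deg u}"
    using assms by (simp add: off_Suc add.commute)
  then have "adj ` {off u..<off (Suc u)} = (\<lambda>j. adj (off u + j)) ` {0..<deg u}"
    by (simp only: image_image)
  also have "\<dots> = (!) (nbs ! u) ` {0..<deg u}" using nth by (intro image_cong) simp_all
  also have "\<dots> = set (nbs ! u)" by (auto simp: deg_def set_conv_nth)
  finally show ?thesis using nbs assms by (simp add: adjacency_lists_def)
qed

lemma adj_edge: "u < n \<Longrightarrow> off u \<le> i \<Longrightarrow> i < off (Suc u) \<Longrightarrow> {u, adj i} \<in> E"
  using adj_image[of u] by auto

lemma adj_less: "u < n \<Longrightarrow> i < off (Suc u) \<Longrightarrow> i < off n"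
  using off_mono[of "Suc u" n] by simp

text \<open>The state of a search from \<open>b\<close> with distances \<open>d\<close> and queue \<open>q\<close>, while the queue entry
  number \<open>h\<close> is being expanded: the entries before \<open>h\<close> have been expanded, and \<open>W\<close> contains the
  neighbours of the current vertex seen so far.\<close>

definition bfs_inv ::
    "nat \<Rightarrow> (nat \<Rightarrow> nat) \<Rightarrow> (nat \<Rightarrow> nat) \<Rightarrow> nat \<Rightarrow> nat \<Rightarrow> nat set \<Rightarrow> bool" where
  "bfs_inv b d q h rear W \<longleftrightarrow>
     h \<le> rear \<and> 0 < rear \<and> q 0 = b \<and> d b = 0 \<and> inj_on q {..<rear} \<and>
     q ` {..<rear} = {v. v < n \<and> d v \<le> n} \<and> (\<forall>v<n. d v \<le> Suc n) \<and>
     (\<forall>j<rear. d (q j) \<le> j \<and> (b, q j) \<in> adj_rel E ^^ d (q j)) \<and>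
     (\<forall>i j. i \<le> j \<longrightarrow> j < rear \<longrightarrow> d (q i) \<le> d (q j)) \<and>
     (h < rear \<longrightarrow> (\<forall>j<rear. d (q j) \<le> Suc (d (q h)))) \<and>
     (\<forall>j<h. \<forall>w. {q j, w} \<in> E \<longrightarrow> d w \<le> Suc (d (q j))) \<and>
     (\<forall>w\<in>W. d w \<le> Suc (d (q h)))"

lemma bfs_invD:
  assumes "bfs_inv b d q h rear W"
  shows "h \<le> rear" "0 < rear" "q 0 = b" "d b = 0" "inj_on q {..<rear}"
    "q ` {..<rear} = {v. v < n \<and> d v \<le> n}" "\<forall>v<n. d v \<le> Suc n"
    "\<And>j. j < rear \<Longrightarrow> d (q j) \<le> j" "\<And>j. j < rear \<Longrightarrow> (b, q j) \<in> adj_rel E ^^ d (q j)"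
    "\<And>i j. i \<le> j \<Longrightarrow> j < rear \<Longrightarrow> d (q i) \<le> d (q j)"
    "\<And>j. h < rear \<Longrightarrow> j < rear \<Longrightarrow> d (q j) \<le> Suc (d (q h))"
    "\<And>j w. j < h \<Longrightarrow> {q j, w} \<in> E \<Longrightarrow> d w \<le> Suc (d (q j))"
    "\<And>w. w \<in> W \<Longrightarrow> d w \<le> Suc (d (q h))"
    "\<And>j. j < rear \<Longrightarrow> q j < n" "\<And>j. j < rear \<Longrightarrow> d (q j) \<le> n"
proof -
  show im: "q ` {..<rear} = {v. v < n \<and> d v \<le> n}"
    using assms unfolding bfs_inv_def by (elim conjE)
  show "q j < n" "d (q j) \<le> n" if "j < rear" for j
  proof -
    have "q j \<in> q ` {..<rear}" using that by simp
    then show "q j < n" "d (q j) \<le> n" unfolding im by simp_all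
  qed
qed (use assms in \<open>simp_all add: bfs_inv_def\<close>)

lemma bfs_inv_queued:
  assumes "bfs_inv b d q h rear W" "v < n" "d v \<le> n"
  obtains j where "j < rear" "v = q j"
proof -
  have "v \<in> q ` {..<rear}" using bfs_invD(6)[OF assms(1)] assms(2,3) by simp
  then show ?thesis using that by auto
qed

lemma bfs_inv_rear_le:
  assumes "bfs_inv b d q h rear W"
  shows "rear \<le> n"
proof -
  have "card (q ` {..<rear}) = rear" using bfs_invD(5)[OF assms] by (simp add: card_image)
  moreover have "q ` {..<rear} \<subseteq> {..<n}" using bfs_invD(14)[OF assms] by auto
  ultimately show ?thesis using card_mono[of "{..<n}" "q ` {..<rear}"] by simp
qed

lemma bfs_inv_init:
  assumes "b < n" "\<And>v. v < n \<Longrightarrow> d v = (if v = b then 0 else Suc n)" "q 0 = b"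
  shows "bfs_inv b d q 0 1 {}"
  using assms by (auto simp: bfs_inv_def lessThan_Suc split: if_splits)

text \<open>A neighbour that is already labelled is in the queue, and queued labels exceed that of
  the head by at most 1.\<close>

lemma bfs_inv_skip:
  "bfs_inv b d q h rear W \<Longrightarrow> h < rear \<Longrightarrow> w < n \<Longrightarrow> d w \<le> n \<Longrightarrow> bfs_inv b d q h rear (insert w W)"
proof -
  assume i: "bfs_inv b d q h rear W" and h: "h < rear" and w: "w < n" "d w \<le> n"
  from bfs_inv_queued[OF i w] obtain j where "j < rear" "w = q j" .
  then have "d w \<le> Suc (d (q h))" using bfs_invD(11)[OF i h] by simp
  with i show "bfs_inv b d q h rear (insert w W)" unfolding bfs_inv_def by simp
qed

text \<open>The new label \<open>Suc (d (q h))\<close> is the largest that the queue may contain, so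
  appending \<open>w\<close> keeps the labels sorted and within 1 of the head.\<close>

lemma bfs_inv_discover:
  assumes i: "bfs_inv b d q h rear W" and h: "h < rear" and e: "{q h, w} \<in> E" and w: "n < d w"
  shows "bfs_inv b (d(w := Suc (d (q h)))) (q(rear := w)) h (Suc rear) (insert w W)"
    (is "bfs_inv b ?d ?q h (Suc rear) _")
proof -
  note I = bfs_invD[OF i]
  have rear: "rear \<le> n" by (rule bfs_inv_rear_le[OF i])
  have wn: "w < n" using edge_bound[OF e] by simp
  have ne: "q j \<noteq> w" if "j < rear" for j using I(15)[OF that] w by auto
  have old: "?d (?q j) = d (q j)" "?q j = q j" if "j < rear" for j using ne[OF that] that by auto
  have new: "?d (?q rear) = Suc (d (q h))" by simp
  \<comment> \<open>Labels are bounded by queue positions, and positions by \<open>n\<close>; this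
    keeps a new label apart from the marker \<open>Suc n\<close>.\<close>
  have dh: "Suc (d (q h)) \<le> rear" using I(8)[OF h] h by simp
  show ?thesis unfolding bfs_inv_def
  proof (intro conjI allI impI ballI)
    show "h \<le> Suc rear" "0 < Suc rear" using h by simp_all
    show "?q 0 = b" using old(2)[of 0] I(2,3) by simp
    show "?d b = 0" using I(4) w by auto
    show "inj_on ?q {..<Suc rear}"
      using inj_on_fun_updI[OF I(5), of w rear] ne by (auto simp: lessThan_Suc)
    show "?q ` {..<Suc rear} = {v. v < n \<and> ?d v \<le> n}"
    proof -
      have "?q ` {..<Suc rear} = insert w (q ` {..<rear})" by (auto simp: lessThan_Suc)
      also have "\<dots> = {v. v < n \<and> ?d v \<le> n}" using I(6) wn dh rear by auto
      finally show ?thesis .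
    qed
    show "?d v \<le> Suc n" if "v < n" for v using I(7) that dh rear by simp
    show "?d (?q j) \<le> j" if "j < Suc rear" for j
      using old(1)[of j] I(8)[of j] new dh that less_Suc_eq by metis
    show "(b, ?q j) \<in> adj_rel E ^^ ?d (?q j)" if "j < Suc rear" for j
    proof (cases "j = rear")
      case True
      have "(q h, w) \<in> adj_rel E" using e by (simp add: adj_rel_def)
      with I(9)[OF h] True show ?thesis by auto
    next
      case False
      then have j: "j < rear" using that by simp
      show ?thesis using I(9)[OF j] ne[OF j] j by simp
    qed
    show "?d (?q i) \<le> ?d (?q j)" if "i \<le> j" "j < Suc rear" for i j
    proof (cases "j = rear")
      case True
      then show ?thesis using old(1)[of i] I(11)[OF h, of i] new that by (cases "i = rear") auto
    next
      case False
      then show ?thesis using old(1)[of i] old(1)[of j] I(10)[of i j] that by simp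
    qed
    show "?d (?q j) \<le> Suc (?d (?q h))" if "j < Suc rear" for j
      using old(1)[of j] old(1)[OF h] I(11)[OF h, of j] new that by (cases "j = rear") auto
    show "?d v \<le> Suc (?d (?q j))" if "j < h" "{?q j, v} \<in> E" for j v
    proof -
      have j: "j < rear" using that(1) h by simp
      have "d v \<le> Suc (d (q j))" using I(12)[OF that(1)] that(2) old(2)[OF j] by simp
      \<comment> \<open>Neighbours of expanded vertices have labels at most \<open>n\<close>,
        whereas \<open>w\<close> was undiscovered.\<close>
      moreover have "v \<noteq> w" using calculation I(8)[OF j] j rear w by auto
      ultimately show ?thesis using old(1)[OF j] by simp
    qed
    show "?d v \<le> Suc (?d (?q h))" if "v \<in> insert w W" for v
      using that I(13) old(1)[OF h] by auto
  qed
qed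

text \<open>Once \<open>W\<close> holds all neighbours, its clause becomes the closure clause for
  position \<open>h\<close>. The labels stay within 1 of the new head because they are
  sorted.\<close>

lemma bfs_inv_advance:
  assumes i: "bfs_inv b d q h rear W" and h: "h < rear" and W: "W = {v. {q h, v} \<in> E}"
  shows "bfs_inv b d q (Suc h) rear {}"
proof -
  note I = bfs_invD[OF i]
  have "d w \<le> Suc (d (q j))" if "j < Suc h" "{q j, w} \<in> E" for j w
    using that I(12,13) W less_Suc_eq by auto
  moreover have "d (q j) \<le> Suc (d (q (Suc h)))" if "Suc h < rear" "j < rear" for j
    using I(11)[OF h that(2)] I(10)[of h "Suc h"] that by simp
  ultimately show ?thesis unfolding bfs_inv_def
  proof (intro conjI allI impI ballI)
    show "Suc h \<le> rear" using h by simp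
    show "d (q j) \<le> Suc (d (q (Suc h)))" if "Suc h < rear" "j < rear" for j
      using \<open>\<And>j. Suc h < rear \<Longrightarrow> j < rear \<Longrightarrow> d (q j) \<le> Suc (d (q (Suc h)))\<close> that .
    show "d w \<le> Suc (d (q j))" if "j < Suc h" "{q j, w} \<in> E" for j w
      using \<open>\<And>j w. j < Suc h \<Longrightarrow> {q j, w} \<in> E \<Longrightarrow> d w \<le> Suc (d (q j))\<close> that .
  qed (use I(2,3,4,5,6,7) I(8,9,10) in \<open>blast+\<close>)
qed

text \<open>With the queue exhausted, every edge at a queued vertex raises the label by at most 1,
  so labels are bounded by walk lengths; conversely a label of at most \<open>n\<close> is itself
  the length of a walk.\<close>

lemma bfs_inv_final:
  assumes i: "bfs_inv b d q rear rear {}" and v: "v < n"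
  shows "d v = D b v"
proof -
  note I = bfs_invD[OF i]
  have rear: "rear \<le> n" by (rule bfs_inv_rear_le[OF i])
  \<comment> \<open>\<open>d x \<le> n\<close> is carried along because it puts the vertex into the
    queue, where the closure clause applies to its next edge.\<close>
  have walk: "d x \<le> k \<and> d x \<le> n \<and> x < n" if "(b, x) \<in> adj_rel E ^^ k" for x k
    using that
  proof (induction k arbitrary: x)
    case 0
    then show ?case using I(2,3,4) I(14)[of 0] by simp
  next
    case (Suc k)
    then obtain w where w: "(b, w) \<in> adj_rel E ^^ k" "{w, x} \<in> E" by (auto simp: adj_rel_def)
    from bfs_inv_queued[OF i, of w] Suc.IH[OF w(1)] obtain j where j: "j < rear" "w = q j" by metis
    have "d x \<le> Suc (d w)" using I(12)[OF j(1)] w(2) j(2) by simp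
    with Suc.IH[OF w(1)] I(8)[OF j(1)] j rear edge_bound[OF w(2)] show ?case by simp
  qed
  show ?thesis
  proof (cases "d v \<le> n")
    case True
    from bfs_inv_queued[OF i v this] obtain j where j: "j < rear" "v = q j" .
    have "gdist E b v \<le> enat (d v)" using gdist_le_relpow[OF I(9)[OF j(1)]] j(2) by simp
    then obtain k where k: "gdist E b v = enat k" "k \<le> d v" by (cases "gdist E b v") auto
    with walk[OF gdist_eq_enatD[OF k(1)]] show ?thesis by (simp add: capped_dist_def)
  next
    case False
    then have "d v = Suc n" using I(7) v by (auto simp: le_Suc_eq)
    moreover have "gdist E b v = \<infinity>"
    proof (cases "gdist E b v")
      case (enat k)
      from walk[OF gdist_eq_enatD[OF enat]] False show ?thesis by simp
    qed
    ultimately show ?thesis by (simp add: capped_dist_def)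
  qed
qed

section \<open>Correctness and running time of the search\<close>

lemma run_bfs_scan:
  assumes enc: "encodes s" and i: "regs s 2 = i" "i < off n" and u: "regs s 1 = u"
    and inv: "bfs_inv b (arrs s 4) (arrs s 5) h (regs s 8) W"
    and h: "h < regs s 8" "arrs s 5 h = u" and e: "{u, adj i} \<in> E"
  shows "run bfs_scan s 20 (\<lambda>s' _. agree {8} {4, 5} s s' \<and>
     h < regs s' 8 \<and> (\<forall>j\<le>h. arrs s' 5 j = arrs s 5 j) \<and>
     bfs_inv b (arrs s' 4) (arrs s' 5) h (regs s' 8) (insert (adj i) W))"
proof -
  note en = encodesD[OF enc]
  have a: "arrs s (Suc 0) i = adj i" using en(3)[OF i(2)] by simp
  show ?thesis
  proof (cases "n < arrs s 4 (adj i)")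
    case True
    have "bfs_inv b ((arrs s 4)(adj i := Suc (arrs s 4 u))) ((arrs s 5)(regs s 8 := adj i)) h
        (Suc (regs s 8)) (insert (adj i) W)"
      using bfs_inv_discover[OF inv h(1), of "adj i"] e h(2) True by simp
    then show ?thesis using True h
      by (simp add: bfs_scan_def en(1) i(1) u[simplified] a agree_def)
  next
    case False
    with bfs_inv_skip[OF inv h(1), of "adj i"] edge_bound[OF e] show ?thesis
      using h by (simp add: bfs_scan_def en(1) i(1) u[simplified] a agree_def)
  qed
qed

text \<open>The factor 29 consists of 20 for a scan and 9 for the loop test and increment. Queue
  entries up to \<open>h\<close> must be preserved so that the caller's record of expanded vertices
  remains valid.\<close>

lemma run_bfs_visit:
  assumes enc: "encodes s" and inv: "bfs_inv b (arrs s 4) (arrs s 5) h (regs s 8) {}"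
    and h: "h < regs s 8" "regs s 7 = h" and u: "u = arrs s 5 h"
  shows "run bfs_visit s (29 * deg u + 20) (\<lambda>s' _. agree {1, 2, 7, 8} {4, 5} s s' \<and>
     regs s' 7 = Suc h \<and> (\<forall>j\<le>h. arrs s' 5 j = arrs s 5 j) \<and>
     bfs_inv b (arrs s' 4) (arrs s' 5) (Suc h) (regs s' 8) {})"
proof -
  have un: "u < n" using bfs_invD(14)[OF inv h(1)] u by simp
  let ?s1 = "s\<lparr>regs := (regs s)(1 := u)\<rparr>"
  let ?I = "\<lambda>k s'. agree {1, 2, 8} {4, 5} s s' \<and> regs s' 1 = u \<and> h < regs s' 8 \<and>
     (\<forall>j\<le>h. arrs s' 5 j = arrs s 5 j) \<and>
     bfs_inv b (arrs s' 4) (arrs s' 5) h (regs s' 8) (adj ` {off u..<k})"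
  have ext: "adj ` {off u..<Suc k} = insert (adj k) (adj ` {off u..<k})" if "off u \<le> k" for k
    using that by (simp add: atLeastLessThanSuc)
  have offs: "arrs s' 0 u = off u" "arrs s' 0 (Suc u) = off (Suc u)"
    if "agree {1, 2, 8} {4, 5} s s'" for s'
  proof -
    have "encodes s'" by (rule encodes_agree[OF enc that]) simp_all
    then show "arrs s' 0 u = off u" "arrs s' 0 (Suc u) = off (Suc u)"
      using un by (simp_all add: encodesD(2))
  qed
  have loop: "run (for_loop 2 (Cell 0 (Reg 1)) (Cell 0 (Inc (Reg 1))) bfs_scan) ?s1
      (29 * deg u + 9) (\<lambda>s' _. ?I (off (Suc u)) s')"
  proof (rule run_for_loop[where I = ?I and lo = "off u" and c = "\<lambda>_. 20"])
    fix k s' assume k: "off u \<le> k" "k < off (Suc u)" and I: "?I k s'" and r: "regs s' 2 = k"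
    have enc': "encodes s'" by (rule encodes_agree[OF enc conjunct1[OF I]]) simp_all
    have "run bfs_scan s' 20 (\<lambda>s'' _. agree {8} {4, 5} s' s'' \<and>
        h < regs s'' 8 \<and> (\<forall>j\<le>h. arrs s'' 5 j = arrs s' 5 j) \<and>
        bfs_inv b (arrs s'' 4) (arrs s'' 5) h (regs s'' 8) (insert (adj k) (adj ` {off u..<k})))"
    proof (rule run_bfs_scan[OF enc' r adj_less[OF un k(2)]])
      show "{u, adj k} \<in> E" by (rule adj_edge[OF un k])
      show "regs s' 1 = u" "bfs_inv b (arrs s' 4) (arrs s' 5) h (regs s' 8) (adj ` {off u..<k})"
        "h < regs s' 8" "arrs s' 5 h = u"
        using I u by simp_all
    qed
    then show "run bfs_scan s' 20 (\<lambda>s'' _. regs s'' 2 = k \<and>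
        ?I (Suc k) (s''\<lparr>regs := (regs s'')(2 := Suc k)\<rparr>))"
    proof (rule run_mono)
      fix s'' t
      assume s'': "agree {8} {4, 5} s' s'' \<and> h < regs s'' 8 \<and>
        (\<forall>j\<le>h. arrs s'' 5 j = arrs s' 5 j) \<and>
        bfs_inv b (arrs s'' 4) (arrs s'' 5) h (regs s'' 8) (insert (adj k) (adj ` {off u..<k}))"
      have "agree {1, 2, 8} {4, 5} s s''"
        by (rule agree_trans[OF conjunct1[OF I] conjunct1[OF s'']]) simp_all
      then have "agree {1, 2, 8} {4, 5} s (s''\<lparr>regs := (regs s'')(2 := Suc k)\<rparr>)"
        by (simp add: agree_def)
      moreover have "regs s'' 2 = k" "regs s'' 1 = u"
        using I r agree_reg[OF conjunct1[OF s''], of 2] agree_reg[OF conjunct1[OF s''], of 1]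
        by simp_all
      ultimately show "regs s'' 2 = k \<and> ?I (Suc k) (s''\<lparr>regs := (regs s'')(2 := Suc k)\<rparr>)"
        using s'' I unfolding ext[OF k(1)] by simp
    qed
  next
    show "eval_exp (Cell 0 (Inc (Reg 1))) s' = off (Suc u)" if "?I k s'" for k s'
      using that offs by simp
    show "eval_exp (Cell 0 (Reg 1)) ?s1 = off u"
      using offs(1)[of ?s1] by (simp add: agree_def)
    show "off u \<le> off (Suc u)" using un by (simp add: off_mono)
    show "?I (off u) (?s1\<lparr>regs := (regs ?s1)(2 := off u)\<rparr>)"
      using inv h by (simp add: agree_def)
  qed (simp add: off_Suc[OF un])
  have fin: "agree {1, 2, 7, 8} {4, 5} s (s'\<lparr>regs := (regs s')(7 := Suc h)\<rparr>) \<and>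
      bfs_inv b (arrs s' 4) (arrs s' 5) (Suc h) (regs s' 8) {} \<and> regs s' 7 = h"
    if I: "?I (off (Suc u)) s'" for s'
  proof -
    have "bfs_inv b (arrs s' 4) (arrs s' 5) (Suc h) (regs s' 8) {}"
    proof (rule bfs_inv_advance)
      show "bfs_inv b (arrs s' 4) (arrs s' 5) h (regs s' 8) (adj ` {off u..<off (Suc u)})"
        "h < regs s' 8"
        using I by simp_all
      show "adj ` {off u..<off (Suc u)} = {v. {arrs s' 5 h, v} \<in> E}"
        using I u adj_image[OF un] by simp
    qed
    moreover have "regs s' 7 = h" using agree_reg[OF conjunct1[OF I], of 7] h by simp
    ultimately show ?thesis using I by (simp add: agree_def)
  qed
  have "run (for_loop 2 (Cell 0 (Reg 1)) (Cell 0 (Inc (Reg 1))) bfs_scan) ?s1 (29 * deg u + 17)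
     (\<lambda>s' t'. run (Assign 7 (Inc (Reg 7))) s' t' (\<lambda>s' _. agree {1, 2, 7, 8} {4, 5} s s' \<and>
     regs s' 7 = Suc h \<and> (\<forall>j\<le>h. arrs s' 5 j = arrs s 5 j) \<and>
     bfs_inv b (arrs s' 4) (arrs s' 5) (Suc h) (regs s' 8) {}))"
  proof (rule run_budget[OF loop])
    fix s' t' assume I: "?I (off (Suc u)) s'" and t': "29 * deg u + 17 - (29 * deg u + 9) \<le> t'"
    show "run (Assign 7 (Inc (Reg 7))) s' t' (\<lambda>s' _. agree {1, 2, 7, 8} {4, 5} s s' \<and>
     regs s' 7 = Suc h \<and> (\<forall>j\<le>h. arrs s' 5 j = arrs s 5 j) \<and>
     bfs_inv b (arrs s' 4) (arrs s' 5) (Suc h) (regs s' 8) {})"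
      using fin[OF I] I t' by simp
  qed simp
  then show ?thesis using h u by (simp add: bfs_visit_def add.commute[of 17])
qed

lemma run_bfs:
  assumes enc: "encodes s" and b: "regs s 6 = b" "b < n"
  shows "run bfs s (100 * (n + off n + 1)) (\<lambda>s' _. agree {1, 2, 7, 8, 9} {4, 5} s s' \<and>
     (\<forall>v<n. arrs s' 4 v = D b v))"
proof -
  let ?I = "\<lambda>k s'. agree {9} {4} s s' \<and> (\<forall>v<k. arrs s' 4 v = Suc n)"
  let ?Q = "\<lambda>s' _. agree {1, 2, 7, 8, 9} {4, 5} s s' \<and> (\<forall>v<n. arrs s' 4 v = D b v)"
  have clear: "run (for_loop 9 (Const 0) (Reg 0) (Store 4 (Reg 9) (Inc (Reg 0)))) s
      (11 * n + 6) (\<lambda>s' _. ?I n s')"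
    by (rule run_for_loop_const[where I = ?I and c = 4])
      (use encodesD(1)[OF enc] in \<open>auto simp: agree_def less_Suc_eq\<close>)
  \<comment> \<open>The potential: each vertex not yet expanded reserves 20 plus
    \<open>29 * deg v\<close> for its visit and 4 for the test of the \<open>While\<close>. The
    extra 4 in \<open>?J\<close> pays for the final failing test.\<close>
  let ?rest = "\<lambda>h s'. \<Sum>v\<in>{..<n} - arrs s' 5 ` {..<h}. 29 * deg v + 24"
  let ?J = "\<lambda>s' t. \<exists>h. regs s' 7 = h \<and> agree {1, 2, 7, 8, 9} {4, 5} s s' \<and>
     bfs_inv b (arrs s' 4) (arrs s' 5) h (regs s' 8) {} \<and> ?rest h s' + 4 \<le> t"
  have search: "run (While (Less (Reg 7) (Reg 8)) bfs_visit) s' t ?Q" if "?J s' t" for s' t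
    using that
  proof (rule run_While[where I = ?J, rotated])
    fix s' t assume "?J s' t"
    then obtain h where J: "regs s' 7 = h" "agree {1, 2, 7, 8, 9} {4, 5} s s'"
      "bfs_inv b (arrs s' 4) (arrs s' 5) h (regs s' 8) {}" "?rest h s' + 4 \<le> t" by blast
    let ?b = "Less (Reg 7) (Reg 8)"
    show "1 + test_cost ?b \<le> t \<and>
      (if eval_test ?b s' then run bfs_visit s' (t - (1 + test_cost ?b)) ?J
       else ?Q s' (t - (1 + test_cost ?b)))"
    proof (cases "h < regs s' 8")
      case False
      then have "regs s' 8 = h" using bfs_invD(1)[OF J(3)] by simp
      with J(1,2,4) bfs_inv_final[of b "arrs s' 4" "arrs s' 5" h] J(3) show ?thesis by auto
    next
      case True
      define u where "u = arrs s' 5 h"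
      have enc': "encodes s'" by (rule encodes_agree[OF enc J(2)]) simp_all
      have un: "u < n" using bfs_invD(14)[OF J(3) True] u_def by simp
      \<comment> \<open>The queue has no repetitions, so the share of \<open>u\<close> in
        \<open>?rest\<close> has not been spent.\<close>
      have "u \<notin> arrs s' 5 ` {..<h}"
        using bfs_invD(5)[OF J(3)] True unfolding u_def inj_on_def by force
      with un have mem: "u \<in> {..<n} - arrs s' 5 ` {..<h}" by simp
      have split: "?rest h s' = 29 * deg u + 24 + ?rest (Suc h) s'"
      proof -
        have "{..<n} - arrs s' 5 ` {..<Suc h} = {..<n} - arrs s' 5 ` {..<h} - {u}"
          by (auto simp: lessThan_Suc u_def)
        then show ?thesis using sum.remove[OF _ mem, of "\<lambda>v. 29 * deg v + 24"] by simp
      qed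
      have same: "?rest (Suc h) s'' = ?rest (Suc h) s'"
        if "\<forall>j\<le>h. arrs s'' 5 j = arrs s' 5 j" for s''
      proof -
        have "arrs s'' 5 ` {..<Suc h} = arrs s' 5 ` {..<Suc h}"
          using that by (intro image_cong) auto
        then show ?thesis by simp
      qed
      have "run bfs_visit s' (t - 4) ?J"
      proof (rule run_budget[OF run_bfs_visit[OF enc' J(3) True J(1) u_def]])
        show "29 * deg u + 20 \<le> t - 4" using J(4) split by simp
      next
        fix s'' t'
        assume v: "agree {1, 2, 7, 8} {4, 5} s' s'' \<and> regs s'' 7 = Suc h \<and>
            (\<forall>j\<le>h. arrs s'' 5 j = arrs s' 5 j) \<and>
            bfs_inv b (arrs s'' 4) (arrs s'' 5) (Suc h) (regs s'' 8) {}"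
          and t': "t - 4 - (29 * deg u + 20) \<le> t'"
        have "agree {1, 2, 7, 8, 9} {4, 5} s s''"
          using v by (intro agree_trans[OF J(2)]) auto
        moreover have "?rest (Suc h) s'' + 4 \<le> t'"
          using same v t' split J(4) by simp
        ultimately show "?J s'' t'" using v by blast
      qed
      moreover have "1 + test_cost ?b = 4" by simp
      ultimately show ?thesis using True J(1,4) by (simp only: eval_test.simps eval_exp.simps) simp
    qed
  qed
  have total: "(\<Sum>v<n. 29 * deg v + 24) = 29 * off n + 24 * n"
    using sum_deg[of n] by (simp add: sum.distrib sum_distrib_left[symmetric])
  have launch: "run (While (Less (Reg 7) (Reg 8)) bfs_visit) s' t ?Q"
    if a: "agree {7, 8, 9} {4, 5} s s'" and r: "regs s' 7 = 0" "regs s' 8 = 1"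
      and d: "\<And>v. v < n \<Longrightarrow> arrs s' 4 v = (if v = b then 0 else Suc n)" and q: "arrs s' 5 0 = b"
      and t: "29 * off n + 24 * n + 4 \<le> t" for s' t
  proof (rule search, intro exI conjI)
    show "regs s' 7 = 0" by (rule r)
    show "agree {1, 2, 7, 8, 9} {4, 5} s s'" using a by (simp add: agree_def)
    show "bfs_inv b (arrs s' 4) (arrs s' 5) 0 (regs s' 8) {}"
      unfolding r(2) by (rule bfs_inv_init) (rule b d q | assumption)+
    show "?rest 0 s' + 4 \<le> t" using t total by simp
  qed
  show ?thesis
    unfolding bfs_def run_Seq
  proof (rule run_budget[OF clear])
    fix s' t'
    assume I: "?I n s'" and t: "100 * (n + off n + 1) - (11 * n + 6) \<le> t'"
    have r: "regs s' 6 = b" using I b by (simp add: agree_def)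
    show "run (Store 4 (Reg 6) (Const 0)) s' t'
        (\<lambda>s' t'. run (Store 5 (Const 0) (Reg 6)) s' t'
        (\<lambda>s' t'. run (Assign 7 (Const 0)) s' t'
        (\<lambda>s' t'. run (Assign 8 (Const 1)) s' t'
        (\<lambda>s' t'. run (While (Less (Reg 7) (Reg 8)) bfs_visit) s' t' ?Q))))"
      by (simp add: r del: One_nat_def, intro conjI launch) (use I t b in \<open>auto simp: agree_def\<close>)
  qed simp
qed


end
section \<open>The algorithm\<close>

text \<open>Array 6 marks the vertices with a neighbour on the other side of the partition.\<close>

definition mark_edge :: prog where
  "mark_edge =
     Cond (Neg (Conj (Neg (Less (Cell 2 (Reg 1)) (Cell 2 (Cell 1 (Reg 2)))))
                     (Neg (Less (Cell 2 (Cell 1 (Reg 2))) (Cell 2 (Reg 1))))))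
       (Store 6 (Reg 1) (Const 1)) Skip"

definition mark :: prog where
  "mark = for_loop 1 (Const 0) (Reg 0)
     (for_loop 2 (Cell 0 (Reg 1)) (Cell 0 (Inc (Reg 1))) mark_edge)"

text \<open>Registers 3 and 4 count the marked vertices of \<open>S\<close> and \<open>T\<close>, register 5 tells whether the
  boundary lies in \<open>S\<close>, and register 12 is set to \<open>2 n + 2\<close>.\<close>

definition count_vertex :: prog where
  "count_vertex =
     Seq (Assign 12 (Inc (Reg 12)))
    (Seq (Store 7 (Reg 1) (Inc (Reg 0)))
         (Cond (Less (Const 0) (Cell 6 (Reg 1)))
            (Cond (Less (Const 0) (Cell 2 (Reg 1))) (Assign 3 (Inc (Reg 3))) (Assign 4 (Inc (Reg 4))))
            Skip))"

definition choose_side :: prog where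
  "choose_side =
     Seq (Assign 12 (Inc (Inc (Reg 0))))
    (Seq (for_loop 1 (Const 0) (Reg 0) count_vertex)
         (Cond (Less (Reg 4) (Reg 3)) (Assign 5 (Const 0)) (Assign 5 (Const 1))))"

definition max_target :: "nat \<Rightarrow> nat \<Rightarrow> prog" where
  "max_target r a = for_loop 9 (Const 0) (Reg 0)
     (Cond (Conj (Less (Cell 2 (Reg 9)) (Const 1)) (Less (Reg r) (Cell a (Reg 9))))
        (Assign r (Cell a (Reg 9))) Skip)"

text \<open>Arrays 7, 8 and 3 accumulate \<open>dist_boundary\<close>, \<open>max_boundary\<close> and \<open>slack_boundary\<close>.\<close>

definition update_vertex :: prog where
  "update_vertex =
     Seq (Store 7 (Reg 9) (Sub (Cell 7 (Reg 9)) (Sub (Cell 7 (Reg 9)) (Cell 4 (Reg 9)))))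
    (Seq (Cond (Less (Cell 8 (Reg 9)) (Cell 4 (Reg 9))) (Store 8 (Reg 9) (Cell 4 (Reg 9))) Skip)
         (Cond (Less (Cell 3 (Reg 9)) (Sub (Reg 10) (Cell 4 (Reg 9))))
            (Store 3 (Reg 9) (Sub (Reg 10) (Cell 4 (Reg 9)))) Skip))"

definition explore :: prog where
  "explore =
     Seq bfs (Seq (Assign 10 (Const 0)) (Seq (max_target 10 4)
       (for_loop 9 (Const 0) (Reg 0) update_vertex)))"

definition explore_boundary :: prog where
  "explore_boundary = for_loop 6 (Const 0) (Reg 0)
     (Cond (Conj (Less (Const 0) (Cell 6 (Reg 6)))
                 (Conj (Neg (Less (Cell 2 (Reg 6)) (Reg 5))) (Neg (Less (Reg 5) (Cell 2 (Reg 6))))))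
        explore Skip)"

text \<open>There is no addition: \<open>x + y\<close> is computed as \<open>w - (w - x - y)\<close> with \<open>w = 2 n + 2\<close>.\<close>

definition output_vertex :: prog where
  "output_vertex =
     Seq (Assign 10 (Sub (Reg 12) (Sub (Sub (Reg 12) (Cell 7 (Reg 9))) (Reg 11))))
    (Seq (Cond (Less (Cell 3 (Reg 9)) (Reg 10)) (Store 3 (Reg 9) (Reg 10)) Skip)
         (Cond (Less (Cell 3 (Reg 9)) (Sub (Cell 8 (Reg 9)) (Const 1)))
            (Store 3 (Reg 9) (Sub (Cell 8 (Reg 9)) (Const 1))) Skip))"

definition eccentricities :: prog where
  "eccentricities =
     Seq mark (Seq choose_side (Seq explore_boundary (Seq (max_target 11 7)
       (for_loop 9 (Const 0) (Reg 0) output_vertex))))"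

context encoded_graph
begin

text \<open>Symmetric in the two sides, so a single pass marks both borders; the indicator of
  \<open>S\<close> separates them afterwards.\<close>

definition crossing :: "nat \<Rightarrow> bool" where
  "crossing v \<longleftrightarrow> (\<exists>w. {v, w} \<in> E \<and> (v \<in> S) \<noteq> (w \<in> S))"

lemma border_crossing:
  "border E S T = {v. v < n \<and> v \<in> S \<and> crossing v}"
  "border E T S = {v. v < n \<and> v \<notin> S \<and> crossing v}"
  using S T edge_bound by (auto simp: border_def crossing_def)

text \<open>The inner loop costs \<open>29 * deg u + 9\<close>, and degrees sum to
  \<open>off n\<close>; so the nested loops are linear in \<open>n + off n\<close>.\<close>

lemma run_mark:
  assumes enc: "encodes s" and zero: "\<And>v. arrs s 6 v = 0"
  shows "run mark s (29 * off n + 16 * n + 6) (\<lambda>s' _. agree {1, 2} {6} s s' \<and>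
     (\<forall>v. arrs s' 6 v = (if v < n \<and> crossing v then 1 else 0)))"
proof -
  let ?I = "\<lambda>u s'. agree {1, 2} {6} s s' \<and>
     (\<forall>v. arrs s' 6 v = (if v < u \<and> crossing v then 1 else 0))"
  let ?inner = "for_loop 2 (Cell 0 (Reg 1)) (Cell 0 (Inc (Reg 1))) mark_edge"
  have "run mark s (29 * off n + 16 * n + 6) (\<lambda>s' _. ?I n s')"
    unfolding mark_def
  proof (rule run_for_loop[where I = ?I and lo = 0 and c = "\<lambda>u. 29 * deg u + 9"])
    fix u s0 assume u: "u < n" and I: "?I u s0" and r: "regs s0 1 = u"
    have enc0: "encodes s0" by (rule encodes_agree[OF enc conjunct1[OF I]]) simp_all
    let ?X = "\<lambda>k. \<exists>i\<in>{off u..<k}. (u \<in> S) \<noteq> (adj i \<in> S)"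
    let ?J = "\<lambda>k s'. agree {1, 2} {6} s s' \<and> regs s' 1 = u \<and>
       (\<forall>v. arrs s' 6 v = (if v < u \<and> crossing v \<or> v = u \<and> ?X k then 1 else 0))"
    have offs: "arrs s' 0 u = off u" "arrs s' 0 (Suc u) = off (Suc u)"
      if "agree {1, 2} {6} s s'" for s'
    proof -
      have "encodes s'" by (rule encodes_agree[OF enc that]) simp_all
      then show "arrs s' 0 u = off u" "arrs s' 0 (Suc u) = off (Suc u)"
        using u by (simp_all add: encodesD(2))
    qed
    have "run ?inner s0 (29 * deg u + 9) (\<lambda>s' _. ?J (off (Suc u)) s')"
    proof (rule run_for_loop[where I = ?J and lo = "off u" and c = "\<lambda>_. 20"])
      fix k s' assume k: "off u \<le> k" "k < off (Suc u)" and J: "?J k s'" and r': "regs s' 2 = k"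
      have enc': "encodes s'" by (rule encodes_agree[OF enc conjunct1[OF J]]) simp_all
      have a: "arrs s' 1 k = adj k" by (rule encodesD(3)[OF enc' adj_less[OF u k(2)]])
      have X: "?X (Suc k) \<longleftrightarrow> ?X k \<or> (u \<in> S) \<noteq> (adj k \<in> S)"
        using k(1) by (auto simp: less_Suc_eq)
      \<comment> \<open>With \<open>Less\<close>, \<open>Neg\<close> and \<open>Conj\<close> as the
        only tests, inequality of the two side bits has to be a negated conjunction.\<close>
      have t: "eval_test (Neg (Conj (Neg (Less (Cell 2 (Reg 1)) (Cell 2 (Cell 1 (Reg 2)))))
           (Neg (Less (Cell 2 (Cell 1 (Reg 2))) (Cell 2 (Reg 1)))))) s' \<longleftrightarrow> (u \<in> S) \<noteq> (adj k \<in> S)"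
        using J r' a by (simp add: encodesD(4)[OF enc'])
      show "run mark_edge s' 20 (\<lambda>s'' _. regs s'' 2 = k \<and>
          ?J (Suc k) (s''\<lparr>regs := (regs s'')(2 := Suc k)\<rparr>))"
        unfolding mark_edge_def run_Cond t X using J r' by (auto simp: agree_def)
    next
      show "eval_exp (Cell 0 (Inc (Reg 1))) s' = off (Suc u)" if "?J k s'" for k s'
        using that offs by simp
      show "eval_exp (Cell 0 (Reg 1)) s0 = off u"
        using offs(1)[OF conjunct1[OF I]] r by simp
      show "off u \<le> off (Suc u)" using u by (simp add: off_mono)
      show "?J (off u) (s0\<lparr>regs := (regs s0)(2 := off u)\<rparr>)"
        using I r by (simp add: agree_def)
    qed (simp add: off_Suc[OF u])
    then show "run ?inner s0 (29 * deg u + 9) (\<lambda>s' _. regs s' 1 = u \<and>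
        ?I (Suc u) (s'\<lparr>regs := (regs s')(1 := Suc u)\<rparr>))"
    proof (rule run_mono)
      fix s' t' assume J: "?J (off (Suc u)) s'"
      have "?X (off (Suc u)) \<longleftrightarrow> (\<exists>w\<in>adj ` {off u..<off (Suc u)}. (u \<in> S) \<noteq> (w \<in> S))" by blast
      then have "?X (off (Suc u)) \<longleftrightarrow> crossing u"
        unfolding adj_image[OF u] crossing_def by blast
      with J show "regs s' 1 = u \<and> ?I (Suc u) (s'\<lparr>regs := (regs s')(1 := Suc u)\<rparr>)"
        by (auto simp: agree_def less_Suc_eq)
    qed
  next
    show "eval_exp (Reg 0) s' = n" if "?I k s'" for k s'
      using encodesD(1)[OF encodes_agree[OF enc conjunct1[OF that]]] by simp
    show "?I 0 (s\<lparr>regs := (regs s)(1 := 0)\<rparr>)" using zero by (simp add: agree_def)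
    have "(\<Sum>u = 0..<n. 29 * deg u + 9 + (exp_cost (Reg 0) + 6)) = 29 * off n + 16 * n"
      using sum_deg[of n]
      by (simp add: sum.distrib sum_distrib_left[symmetric] atLeast0LessThan)
    then show "(\<Sum>u = 0..<n. 29 * deg u + 9 + (exp_cost (Reg 0) + 6)) +
        (exp_cost (Const 0) + exp_cost (Reg 0) + 4) \<le> 29 * off n + 16 * n + 6"
      by simp
  qed simp_all
  then show ?thesis .
qed

text \<open>The last clause yields a constant-time membership test for \<open>B\<close>: a mark
  together with a comparison of the side bit with register 5. The same pass sets array 7 to the
  minimum over the empty set.\<close>

lemma run_choose_side:
  assumes enc: "encodes s" and zero: "regs s 3 = 0" "regs s 4 = 0"
    and marks: "\<And>v. arrs s 6 v = (if v < n \<and> crossing v then 1 else 0)"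
  shows "run choose_side s (27 * n + 16) (\<lambda>s' _. agree {1, 3, 4, 5, 12} {7} s s' \<and>
     regs s' 12 = 2 * n + 2 \<and> (\<forall>v<n. arrs s' 7 v = Suc n) \<and>
     (\<forall>v<n. v \<in> B \<longleftrightarrow> crossing v \<and> regs s' 5 = (if v \<in> S then 1 else 0)))"
proof -
  let ?s1 = "s\<lparr>regs := (regs s)(12 := n + 2)\<rparr>"
  let ?I = "\<lambda>k s'. agree {1, 3, 4, 12} {7} s s' \<and> regs s' 12 = n + 2 + k \<and>
     (\<forall>v<k. arrs s' 7 v = Suc n) \<and> regs s' 3 = card (border E S T \<inter> {..<k}) \<and>
     regs s' 4 = card (border E T S \<inter> {..<k})"
  have count: "run (for_loop 1 (Const 0) (Reg 0) count_vertex) ?s1 (27 * n + 6) (\<lambda>s' _. ?I n s')"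
  proof (rule run_for_loop_const[where I = ?I and c = 20])
    fix k s' assume k: "k < n" and I: "?I k s'" and r: "regs s' 1 = k"
    have enc': "encodes s'" by (rule encodes_agree[OF enc conjunct1[OF I]]) simp_all
    have m: "arrs s' 6 k = (if crossing k then 1 else 0)"
      using agree_arr[OF conjunct1[OF I], of 6] marks k by simp
    have b: "k \<in> border E S T \<longleftrightarrow> k \<in> S \<and> crossing k" "k \<in> border E T S \<longleftrightarrow> k \<notin> S \<and> crossing k"
      using k by (simp_all add: border_crossing)
    show "run count_vertex s' 20 (\<lambda>s'' _. regs s'' 1 = k \<and>
        ?I (Suc k) (s''\<lparr>regs := (regs s'')(1 := Suc k)\<rparr>))"
      using I r m by (auto simp: count_vertex_def encodesD(1,4)[OF enc] encodesD(1,4)[OF enc'] Int_lessThan_Suc b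
          agree_def less_Suc_eq)
  next
    show "eval_exp (Reg 0) s' = n" if "?I k s'" for k s'
      using encodesD(1)[OF encodes_agree[OF enc conjunct1[OF that]]] by simp
    show "?I 0 (?s1\<lparr>regs := (regs ?s1)(1 := 0)\<rparr>)" using zero by (simp add: agree_def)
  qed simp
  have side: "B = (if card (border E S T) \<le> card (border E T S) then border E S T else border E T S)"
    using B_boundary by (simp add: boundary_def)
  have all: "border E S T \<inter> {..<n} = border E S T" "border E T S \<inter> {..<n} = border E T S"
    by (auto simp: border_crossing)
  let ?Q = "\<lambda>s' _. agree {1, 3, 4, 5, 12} {7} s s' \<and>
     regs s' 12 = 2 * n + 2 \<and> (\<forall>v<n. arrs s' 7 v = Suc n) \<and>
     (\<forall>v<n. v \<in> B \<longleftrightarrow> crossing v \<and> regs s' 5 = (if v \<in> S then 1 else 0))"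
  have "run (for_loop 1 (Const 0) (Reg 0) count_vertex) ?s1 (27 * n + 12)
     (\<lambda>s' t'. run (Cond (Less (Reg 4) (Reg 3)) (Assign 5 (Const 0)) (Assign 5 (Const 1))) s' t' ?Q)"
  proof (rule run_budget[OF count])
    fix s' t' assume I: "?I n s'" and t': "27 * n + 12 - (27 * n + 6) \<le> t'"
    \<comment> \<open>The strict comparison resolves a tie in favour of \<open>S\<close>, as
      \<open>boundary\<close> does.\<close>
    show "run (Cond (Less (Reg 4) (Reg 3)) (Assign 5 (Const 0)) (Assign 5 (Const 1))) s' t' ?Q"
      using I t' unfolding side by (auto simp: all agree_def not_less) (auto simp: border_crossing)
  qed simp
  then show ?thesis using encodesD(1)[OF enc]
    by (simp add: choose_side_def add.commute[of 12])
qed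

text \<open>Used twice: on the distances of one search it yields \<open>far_target\<close>, and on
  the finished array 7 it yields \<open>radius\<close>.\<close>

lemma run_max_target:
  assumes enc: "encodes s" and r: "regs s r = 0" "r \<noteq> 0" "r \<noteq> 9"
  shows "run (max_target r a) s (20 * n + 6) (\<lambda>s' _. agree {r, 9} {} s s' \<and>
     regs s' r = max_over (arrs s a) T)"
proof -
  let ?I = "\<lambda>k s'. agree {r, 9} {} s s' \<and> regs s' r = max_over (arrs s a) (T \<inter> {..<k})"
  have "run (max_target r a) s (20 * n + 6) (\<lambda>s' _. ?I n s')"
    unfolding max_target_def
  proof (rule run_for_loop_const[where I = ?I and c = 13])
    fix k s' assume k: "k < n" and I: "?I k s'" and r': "regs s' 9 = k"
    have enc': "encodes s'" by (rule encodes_agree[OF enc conjunct1[OF I]]) (use r in simp_all)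
    have a: "arrs s' a = arrs s a" by (rule agree_arr[OF conjunct1[OF I]]) simp
    have T: "k \<in> T \<longleftrightarrow> k \<notin> S" using k T by simp
    show "run (Cond (Conj (Less (Cell 2 (Reg 9)) (Const 1)) (Less (Reg r) (Cell a (Reg 9))))
        (Assign r (Cell a (Reg 9))) Skip) s' 13 (\<lambda>s'' _. regs s'' 9 = k \<and>
        ?I (Suc k) (s''\<lparr>regs := (regs s'')(9 := Suc k)\<rparr>))"
      using I r r' by (auto simp: encodesD(4)[OF enc] encodesD(4)[OF enc'] max_over_Suc T a agree_def)
  next
    show "eval_exp (Reg 0) s' = n" if "?I k s'" for k s'
      using encodesD(1)[OF encodes_agree[OF enc conjunct1[OF that]]] r by simp
    show "?I 0 (s\<lparr>regs := (regs s)(9 := 0)\<rparr>)" using r by (simp add: agree_def)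
  qed simp
  moreover have "T \<inter> {..<n} = T" using T by auto
  ultimately show ?thesis by simp
qed

lemma run_update:
  assumes enc: "encodes s"
  shows "run (for_loop 9 (Const 0) (Reg 0) update_vertex) s (41 * n + 6)
     (\<lambda>s' _. agree {9} {3, 7, 8} s s' \<and>
       (\<forall>v<n. arrs s' 7 v = min (arrs s 7 v) (arrs s 4 v) \<and>
          arrs s' 8 v = max (arrs s 8 v) (arrs s 4 v) \<and>
          arrs s' 3 v = max (arrs s 3 v) (regs s 10 - arrs s 4 v)))"
proof -
  let ?I = "\<lambda>k s'. agree {9} {3, 7, 8} s s' \<and>
     (\<forall>v. arrs s' 7 v = (if v < k then min (arrs s 7 v) (arrs s 4 v) else arrs s 7 v)) \<and>
     (\<forall>v. arrs s' 8 v = (if v < k then max (arrs s 8 v) (arrs s 4 v) else arrs s 8 v)) \<and>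
     (\<forall>v. arrs s' 3 v = (if v < k then max (arrs s 3 v) (regs s 10 - arrs s 4 v) else arrs s 3 v))"
  have "run (for_loop 9 (Const 0) (Reg 0) update_vertex) s (41 * n + 6) (\<lambda>s' _. ?I n s')"
  proof (rule run_for_loop_const[where I = ?I and c = 34])
    fix k s' assume k: "k < n" and I: "?I k s'" and r: "regs s' 9 = k"
    have same: "arrs s' 4 = arrs s 4" "regs s' 10 = regs s 10"
      using agree_arr[OF conjunct1[OF I], of 4] agree_reg[OF conjunct1[OF I], of 10] by simp_all
    show "run update_vertex s' 34 (\<lambda>s'' _. regs s'' 9 = k \<and>
        ?I (Suc k) (s''\<lparr>regs := (regs s'')(9 := Suc k)\<rparr>))"
      \<comment> \<open>With truncated subtraction \<open>x - (x - y)\<close> is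
        \<open>min x y\<close>.\<close>
      using I r by (auto simp: update_vertex_def same agree_def less_Suc_eq min_def max_def)
  next
    show "eval_exp (Reg 0) s' = n" if "?I k s'" for k s'
      using encodesD(1)[OF encodes_agree[OF enc conjunct1[OF that]]] by simp
    show "?I 0 (s\<lparr>regs := (regs s)(9 := 0)\<rparr>)" by (simp add: agree_def)
  qed simp
  then show ?thesis by (rule run_mono) auto
qed

lemma run_explore:
  assumes enc: "encodes s" and b: "regs s 6 = b" "b < n"
  shows "run explore s (200 * (n + off n + 1)) (\<lambda>s' _.
     agree {1, 2, 7, 8, 9, 10} {3, 4, 5, 7, 8} s s' \<and>
     (\<forall>v<n. arrs s' 7 v = min (arrs s 7 v) (D b v) \<and>
        arrs s' 8 v = max (arrs s 8 v) (D b v) \<and>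
        arrs s' 3 v = max (arrs s 3 v) (far_target b - D b v)))"
    (is "run _ _ _ ?Q")
  unfolding explore_def run_Seq
proof (rule run_budget[OF run_bfs[OF assms]])
  fix s1 t1
  assume s1: "agree {1, 2, 7, 8, 9} {4, 5} s s1 \<and> (\<forall>v<n. arrs s1 4 v = D b v)"
    and t1: "200 * (n + off n + 1) - 100 * (n + off n + 1) \<le> t1"
  let ?s2 = "s1\<lparr>regs := (regs s1)(10 := 0)\<rparr>"
  have a2: "agree {1, 2, 7, 8, 9, 10} {4, 5} s ?s2"
    using s1 by (simp add: agree_def)
  have enc2: "encodes ?s2" by (rule encodes_agree[OF enc a2]) simp_all
  have "run (max_target 10 4) ?s2 (t1 - 2)
      (\<lambda>s' t'. run (for_loop 9 (Const 0) (Reg 0) update_vertex) s' t' ?Q)"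
  proof (rule run_budget[OF run_max_target[OF enc2]])
    fix s3 t3
    assume s3: "agree {10, 9} {} ?s2 s3 \<and> regs s3 10 = max_over (arrs ?s2 4) T"
      and t3: "t1 - 2 - (20 * n + 6) \<le> t3"
    have a3: "agree {1, 2, 7, 8, 9, 10} {4, 5} s s3"
      by (rule agree_trans[OF a2 conjunct1[OF s3]]) auto
    have enc3: "encodes s3" by (rule encodes_agree[OF enc a3]) simp_all
    have "max_over (arrs ?s2 4) T = far_target b"
      unfolding far_target_def max_over_def using s1 T by (simp cong: image_cong_simp)
    then have e: "regs s3 10 = far_target b" using s3 by simp
    have d: "arrs s3 4 v = D b v" if "v < n" for v
      using s1 that agree_arr[OF conjunct1[OF s3], of 4] by simp
    have old: "arrs s3 7 = arrs s 7" "arrs s3 8 = arrs s 8" "arrs s3 3 = arrs s 3"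
      using a3 by (simp_all add: agree_arr)
    show "run (for_loop 9 (Const 0) (Reg 0) update_vertex) s3 t3 ?Q"
    proof (rule run_budget[OF run_update[OF enc3]])
      fix s4 t4
      assume s4: "agree {9} {3, 7, 8} s3 s4 \<and>
       (\<forall>v<n. arrs s4 7 v = min (arrs s3 7 v) (arrs s3 4 v) \<and>
          arrs s4 8 v = max (arrs s3 8 v) (arrs s3 4 v) \<and>
          arrs s4 3 v = max (arrs s3 3 v) (regs s3 10 - arrs s3 4 v))"
      have "agree {1, 2, 7, 8, 9, 10} {3, 4, 5, 7, 8} s s4"
        by (rule agree_trans[OF a3 conjunct1[OF s4]]) auto
      with s4 show "?Q s4 t4" by (simp add: d e old)
    qed (use t1 t3 in simp)
  qed (use t1 in auto)
  then show "run (Assign 10 (Const 0)) s1 t1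
      (\<lambda>s' t'. run (max_target 10 4) s' t'
      (\<lambda>s' t'. run (for_loop 9 (Const 0) (Reg 0) update_vertex) s' t' ?Q))"
    using t1 by (simp add: numeral_2_eq_2)
qed simp

text \<open>All \<open>n\<close> vertices are tested but only those of \<open>B\<close> start a
  search, so \<open>card B\<close> multiplies the search cost alone. Before the first iteration the
  arrays hold the extrema over the empty set.\<close>

lemma run_explore_boundary:
  assumes enc: "encodes s"
    and marks: "\<And>v. v < n \<Longrightarrow> arrs s 6 v = (if crossing v then 1 else 0)"
    and side: "\<And>v. v < n \<Longrightarrow> v \<in> B \<longleftrightarrow> crossing v \<and> regs s 5 = (if v \<in> S then 1 else 0)"
    and init: "\<And>v. v < n \<Longrightarrow> arrs s 7 v = Suc n" "\<And>v. v < n \<Longrightarrow> arrs s 8 v = 0"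
      "\<And>v. v < n \<Longrightarrow> arrs s 3 v = 0"
  shows "run explore_boundary s (200 * (n + off n + 1) * card B + 25 * n + 6) (\<lambda>s' _.
     agree {1, 2, 6, 7, 8, 9, 10} {3, 4, 5, 7, 8} s s' \<and>
     (\<forall>v<n. arrs s' 7 v = dist_boundary v \<and> arrs s' 8 v = max_boundary v \<and>
        arrs s' 3 v = slack_boundary v))"
proof -
  let ?K = "200 * (n + off n + 1)"
  let ?I = "\<lambda>k s'. agree {1, 2, 6, 7, 8, 9, 10} {3, 4, 5, 7, 8} s s' \<and>
     (\<forall>v<n. arrs s' 7 v = min_over (Suc n) (\<lambda>b. D b v) (B \<inter> {..<k}) \<and>
        arrs s' 8 v = max_over (\<lambda>b. D b v) (B \<inter> {..<k}) \<and>
        arrs s' 3 v = max_over (\<lambda>b. far_target b - D b v) (B \<inter> {..<k}))"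
  let ?t = "Conj (Less (Const 0) (Cell 6 (Reg 6)))
     (Conj (Neg (Less (Cell 2 (Reg 6)) (Reg 5))) (Neg (Less (Reg 5) (Cell 2 (Reg 6)))))"
  have "run explore_boundary s (?K * card B + 25 * n + 6) (\<lambda>s' _. ?I n s')"
    unfolding explore_boundary_def
  \<comment> \<open>The 18 units are 17 for the membership test and 1 for
    \<open>Skip\<close>.\<close>
  proof (rule run_for_loop[where I = ?I and lo = 0 and c = "\<lambda>k. (if k \<in> B then ?K else 0) + 18"])
    fix k s' assume k: "k < n" and I: "?I k s'" and r: "regs s' 6 = k"
    have enc': "encodes s'" by (rule encodes_agree[OF enc conjunct1[OF I]]) simp_all
    have "arrs s' 6 k = (if crossing k then 1 else 0)" "regs s' 5 = regs s 5"
      using agree_arr[OF conjunct1[OF I], of 6] agree_reg[OF conjunct1[OF I], of 5] marks[OF k]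
      by simp_all
    then have t: "eval_test ?t s' \<longleftrightarrow> k \<in> B"
      using r by (auto simp: encodesD(4)[OF enc'] side[OF k])
    let ?Q = "\<lambda>s'' _. regs s'' 6 = k \<and> ?I (Suc k) (s''\<lparr>regs := (regs s'')(6 := Suc k)\<rparr>)"
    have c: "1 + test_cost ?t = 17" by simp
    show "run (Cond ?t explore Skip) s' ((if k \<in> B then ?K else 0) + 18) ?Q"
    proof (cases "k \<in> B")
      case False
      have "?Q s' 0" using I False r by (simp add: Int_lessThan_Suc agree_def)
      then show ?thesis unfolding run_Cond t c using False by simp
    next
      case True
      have "run explore s' (?K + 1) ?Q"
      proof (rule run_budget[OF run_explore[OF enc' r k]])
        fix s''
        assume e: "agree {1, 2, 7, 8, 9, 10} {3, 4, 5, 7, 8} s' s'' \<and>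
          (\<forall>v<n. arrs s'' 7 v = min (arrs s' 7 v) (D k v) \<and>
             arrs s'' 8 v = max (arrs s' 8 v) (D k v) \<and>
             arrs s'' 3 v = max (arrs s' 3 v) (far_target k - D k v))"
        have "agree {1, 2, 6, 7, 8, 9, 10} {3, 4, 5, 7, 8} s s''"
          by (rule agree_trans[OF conjunct1[OF I] conjunct1[OF e]]) auto
        then have "agree {1, 2, 6, 7, 8, 9, 10} {3, 4, 5, 7, 8} s
            (s''\<lparr>regs := (regs s'')(6 := Suc k)\<rparr>)"
          by (simp add: agree_def)
        moreover have "regs s'' 6 = k" using agree_reg[OF conjunct1[OF e], of 6] r by simp
        ultimately show "?Q s'' t''" for t''
          using e I True by (simp add: min_over_Suc max_over_Suc)
      qed simp
      then show ?thesis unfolding run_Cond t c using True by simp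
    qed
  next
    show "eval_exp (Reg 0) s' = n" if "?I k s'" for k s'
      using encodesD(1)[OF encodes_agree[OF enc conjunct1[OF that]]] by simp
    show "?I 0 (s\<lparr>regs := (regs s)(6 := 0)\<rparr>)" using init by (simp add: agree_def)
    have "(\<Sum>k = 0..<n. if k \<in> B then ?K else 0) = ?K * card B"
      using B_sub by (simp add: sum.If_cases atLeast0LessThan Int_absorb1)
    then show "(\<Sum>k = 0..<n. (if k \<in> B then ?K else 0) + 18 + (exp_cost (Reg 0) + 6)) +
        (exp_cost (Const 0) + exp_cost (Reg 0) + 4) \<le> ?K * card B + 25 * n + 6"
      by (simp add: sum.distrib)
  qed simp_all
  moreover have "B \<inter> {..<n} = B" using B_sub by auto
  ultimately show ?thesis
    by (simp add: dist_boundary_def max_boundary_def slack_boundary_def)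
qed

lemma run_output:
  assumes enc: "encodes s" and regs: "regs s 12 = 2 * n + 2" "regs s 11 = radius"
    and arrs: "\<And>v. v < n \<Longrightarrow> arrs s 7 v = dist_boundary v"
      "\<And>v. v < n \<Longrightarrow> arrs s 8 v = max_boundary v"
      "\<And>v. v < n \<Longrightarrow> arrs s 3 v = slack_boundary v"
  shows "run (for_loop 9 (Const 0) (Reg 0) output_vertex) s (38 * n + 6)
     (\<lambda>s' _. \<forall>v<n. arrs s' 3 v = est v)"
proof -
  let ?I = "\<lambda>k s'. agree {9, 10} {3} s s' \<and>
     (\<forall>v<n. arrs s' 3 v = (if v < k then est v else slack_boundary v))"
  have le: "dist_boundary v \<le> Suc n" for v
    by (simp add: dist_boundary_def min_over_def)
  have "radius \<le> Suc n" using le by (simp add: radius_def max_over_le_iff)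
  \<comment> \<open>Both summands are at most \<open>Suc n\<close>, so neither subtraction from
    \<open>2 * n + 2\<close> is truncated.\<close>
  then have sum: "2 * n + 2 - (2 * n + 2 - dist_boundary v - radius) = dist_boundary v + radius" for v
    using le[of v] by simp
  have "run (for_loop 9 (Const 0) (Reg 0) output_vertex) s (38 * n + 6) (\<lambda>s' _. ?I n s')"
  proof (rule run_for_loop_const[where I = ?I and c = 31])
    fix k s' assume k: "k < n" and I: "?I k s'" and r: "regs s' 9 = k"
    have "arrs s' 7 k = dist_boundary k" "arrs s' 8 k = max_boundary k"
      "regs s' 12 = 2 * n + 2" "regs s' 11 = radius"
      using agree_arr[OF conjunct1[OF I], of 7] agree_arr[OF conjunct1[OF I], of 8] arrs k
        agree_reg[OF conjunct1[OF I], of 12] agree_reg[OF conjunct1[OF I], of 11] regs by simp_all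
    moreover have "arrs s' 3 k = slack_boundary k" using I k by simp
    ultimately have v: "arrs s' 7 k = dist_boundary k" "arrs s' 8 k = max_boundary k"
      "arrs s' 3 k = slack_boundary k" "regs s' 12 = 2 * n + 2" "regs s' 11 = radius" by simp_all
    have "run output_vertex s' 31 (\<lambda>s'' _. regs s'' 9 = k \<and> agree {9, 10} {3} s' s'' \<and>
        arrs s'' 3 = (arrs s' 3)(k := est k))"
      unfolding output_vertex_def run_Seq run_Assign eval_exp.simps v r sum
      by (auto simp: v r agree_def est_def max_def fun_upd_idem)
    then show "run output_vertex s' 31 (\<lambda>s'' _. regs s'' 9 = k \<and>
        ?I (Suc k) (s''\<lparr>regs := (regs s'')(9 := Suc k)\<rparr>))"
    proof (rule run_mono)
      fix s'' t''
      assume s'': "regs s'' 9 = k \<and> agree {9, 10} {3} s' s'' \<and>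
        arrs s'' 3 = (arrs s' 3)(k := est k)"
      then have "agree {9, 10} {3} s s''" using agree_trans[OF conjunct1[OF I], of _ _ s''] by blast
      with s'' I show "regs s'' 9 = k \<and> ?I (Suc k) (s''\<lparr>regs := (regs s'')(9 := Suc k)\<rparr>)"
        by (simp add: agree_def less_Suc_eq)
    qed
  next
    show "eval_exp (Reg 0) s' = n" if "?I k s'" for k s'
      using encodesD(1)[OF encodes_agree[OF enc conjunct1[OF that]]] by simp
    show "?I 0 (s\<lparr>regs := (regs s)(9 := 0)\<rparr>)" using arrs by (simp add: agree_def)
  qed simp
  then show ?thesis by (rule run_mono) simp
qed

lemma encodes_input: "encodes (input_state n nbs S)"
proof -
  have "take n nbs = nbs" using length_nbs by simp
  then show ?thesis by (simp add: encodes_def input_state_def off_def adj_def)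
qed

theorem run_eccentricities:
  "run eccentricities (input_state n nbs S) (400 * (n + off n + 1) * (card B + 1))
     (\<lambda>s' _. \<forall>v<n. arrs s' 3 v = est v)"
    (is "run _ ?s _ ?Q")
  unfolding eccentricities_def run_Seq
proof (rule run_budget[OF run_mark[OF encodes_input]])
  show "arrs ?s 6 v = 0" for v by (simp add: input_state_def)
next
  let ?K = "n + off n + 1"
  let ?out = "for_loop 9 (Const 0) (Reg 0) output_vertex"
  fix s1 t1
  assume s1: "agree {1, 2} {6} ?s s1 \<and> (\<forall>v. arrs s1 6 v = (if v < n \<and> crossing v then 1 else 0))"
    and t1: "400 * ?K * (card B + 1) - (29 * off n + 16 * n + 6) \<le> t1"
  \<comment> \<open>What marking leaves over: 200 \<open>?K\<close> for each boundary vertex, and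
    300 \<open>?K\<close> for the linear passes.\<close>
  have T1: "200 * ?K * card B + 300 * ?K \<le> t1" using t1 by (simp add: algebra_simps)
  have enc1: "encodes s1" by (rule encodes_agree[OF encodes_input conjunct1[OF s1]]) simp_all
  have r1: "regs s1 3 = 0" "regs s1 4 = 0" "regs s1 11 = 0" "arrs s1 8 v = 0" "arrs s1 3 v = 0" for v
    using s1 by (simp_all add: agree_def input_state_def)
  show "run choose_side s1 t1 (\<lambda>s t. run explore_boundary s t
      (\<lambda>s t. run (max_target 11 7) s t (\<lambda>s t. run ?out s t ?Q)))"
  proof (rule run_budget[OF run_choose_side[OF enc1 r1(1,2)]])
    show "arrs s1 6 v = (if v < n \<and> crossing v then 1 else 0)" for v using s1 by simp
    show "27 * n + 16 \<le> t1" using T1 by simp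
  next
    fix s2 t2
    assume s2: "agree {1, 3, 4, 5, 12} {7} s1 s2 \<and>
       regs s2 12 = 2 * n + 2 \<and> (\<forall>v<n. arrs s2 7 v = Suc n) \<and>
       (\<forall>v<n. v \<in> B \<longleftrightarrow> crossing v \<and> regs s2 5 = (if v \<in> S then 1 else 0))"
      and t2: "t1 - (27 * n + 16) \<le> t2"
    have enc2: "encodes s2" by (rule encodes_agree[OF enc1 conjunct1[OF s2]]) simp_all
    have m2: "arrs s2 6 = arrs s1 6" "arrs s2 8 v = 0" "arrs s2 3 v = 0" "regs s2 11 = 0" for v
      using agree_arr[OF conjunct1[OF s2], of 6] agree_arr[OF conjunct1[OF s2], of 8]
        agree_arr[OF conjunct1[OF s2], of 3] agree_reg[OF conjunct1[OF s2], of 11] r1 by simp_all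
    show "run explore_boundary s2 t2
        (\<lambda>s t. run (max_target 11 7) s t (\<lambda>s t. run ?out s t ?Q))"
    proof (rule run_budget[OF run_explore_boundary[OF enc2]])
      show "arrs s2 6 v = (if crossing v then 1 else 0)" if "v < n" for v
        using s1 that by (simp add: m2)
      show "v \<in> B \<longleftrightarrow> crossing v \<and> regs s2 5 = (if v \<in> S then 1 else 0)" if "v < n" for v
        using s2 that by blast
      show "arrs s2 7 v = Suc n" if "v < n" for v using s2 that by simp
      show "200 * ?K * card B + 25 * n + 6 \<le> t2" using T1 t2 by (simp add: algebra_simps)
    next
      fix s3 t3
      assume s3: "agree {1, 2, 6, 7, 8, 9, 10} {3, 4, 5, 7, 8} s2 s3 \<and>
         (\<forall>v<n. arrs s3 7 v = dist_boundary v \<and> arrs s3 8 v = max_boundary v \<and>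
            arrs s3 3 v = slack_boundary v)"
        and "t2 - (200 * ?K * card B + 25 * n + 6) \<le> t3"
      then have t3: "100 * ?K \<le> t3" using T1 t2 by (simp add: algebra_simps)
      have enc3: "encodes s3" by (rule encodes_agree[OF enc2 conjunct1[OF s3]]) simp_all
      have r3: "regs s3 11 = 0" "regs s3 12 = 2 * n + 2"
        using agree_reg[OF conjunct1[OF s3], of 11] agree_reg[OF conjunct1[OF s3], of 12] m2 s2
        by simp_all
      show "run (max_target 11 7) s3 t3 (\<lambda>s t. run ?out s t ?Q)"
      proof (rule run_budget[OF run_max_target[OF enc3 r3(1)]])
        show "20 * n + 6 \<le> t3" using t3 by simp
      next
        fix s4 t4
        assume s4: "agree {11, 9} {} s3 s4 \<and> regs s4 11 = max_over (arrs s3 7) T"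
          and "t3 - (20 * n + 6) \<le> t4"
        then have t4: "38 * n + 6 \<le> t4" using t3 by simp
        have enc4: "encodes s4" by (rule encodes_agree[OF enc3 conjunct1[OF s4]]) simp_all
        have a4: "arrs s4 = arrs s3" using s4 by (auto simp: agree_def)
        have "max_over (arrs s3 7) T = radius"
          unfolding radius_def max_over_def using s3 T by (simp cong: image_cong_simp)
        then have "regs s4 11 = radius" "regs s4 12 = 2 * n + 2"
          using s4 r3(2) agree_reg[OF conjunct1[OF s4], of 12] by simp_all
        then show "run ?out s4 t4 ?Q"
          by (intro run_budget[OF run_output[OF enc4] t4]) (use s3 in \<open>simp_all add: a4\<close>)
      qed simp_all
    qed (use m2 in simp_all)
  qed
next
  show "29 * off n + 16 * n + 6 \<le> 400 * (n + off n + 1) * (card B + 1)"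
    by (simp add: algebra_simps)
qed

section \<open>From adjacency lists to the number of edges\<close>

text \<open>Handshake argument: \<open>off n\<close> counts the ordered pairs that form an edge, and
  an edge arises from at most two of them.\<close>

lemma off_le_edges: "off n \<le> 2 * card E"
proof -
  have E_sub: "E \<subseteq> Pow {..<n}" using graph by (auto simp: simple_graph_def)
  then have fE: "finite E" by (rule finite_subset) simp
  have "deg u = card {v. {u, v} \<in> E}" if "u < n" for u
    using nbs that distinct_card[of "nbs ! u"] by (simp add: adjacency_lists_def deg_def)
  then have "off n = (\<Sum>u<n. card {v. {u, v} \<in> E})"
    using sum_deg[of n] by simp
  also have "\<dots> = card (SIGMA u:{..<n}. {v. {u, v} \<in> E})"
  proof -
    have "{v. {u, v} \<in> E} \<subseteq> {..<n}" for u using edge_bound by auto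
    then have "finite {v. {u, v} \<in> E}" for u using finite_subset by blast
    then show ?thesis by simp
  qed
  also have "(SIGMA u:{..<n}. {v. {u, v} \<in> E}) = (\<Union>e\<in>E. {(u, v). {u, v} = e})"
    using edge_bound by auto
  also have "card \<dots> \<le> (\<Sum>e\<in>E. card {(u, v). {u, v} = e})"
    by (rule card_UN_le[OF fE])
  also have "\<dots> \<le> (\<Sum>e\<in>E. 2)"
  proof (rule sum_mono)
    fix e assume "e \<in> E"
    then obtain a b where "e = {a, b}" using graph by (auto simp: simple_graph_def)
    then have "{(u, v). {u, v} = e} \<subseteq> {(a, b), (b, a)}" by (auto simp: doubleton_eq_iff)
    from card_mono[OF _ this] show "card {(u, v). {u, v} = e} \<le> 2"
      by (simp add: card_insert_if split: if_splits)
  qed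
  finally show ?thesis by simp
qed

text \<open>These bounds absorb the additive terms of \<open>(n + card E) * (card B + 1)\<close>
  into \<open>card E * card B\<close>. As \<open>S\<close> and \<open>T\<close> are nonempty there
  are two distinct vertices, so in a connected graph each vertex has a neighbour and some walk
  crosses \<open>B\<close>.\<close>

lemma connected_bounds:
  assumes conn: "connected_graph {..<n} E" and S_ne: "S \<noteq> {}"
  shows "n \<le> 2 * card E" "1 \<le> card B"
proof -
  have fE: "finite E"
  proof (rule finite_subset)
    show "E \<subseteq> Pow {..<n}" using graph by (auto simp: simple_graph_def)
  qed simp
  obtain v u where vu: "v \<in> S" "u \<in> T" using S_ne T_ne by blast
  then have lt: "v < n" "u < n" "v \<noteq> u" using S T by auto
  with conn obtain k where "(v, u) \<in> adj_rel E ^^ k"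
    by (auto simp: connected_graph_def rtrancl_power)
  from walk_crosses_boundary[OF this vu] have "B \<noteq> {}" by auto
  then show "1 \<le> card B" by (simp add: Suc_le_eq card_gt_0_iff)
  have "1 \<le> deg x" if "x < n" for x
  proof -
    obtain y where y: "y < n" "x \<noteq> y" using lt by metis
    with conn that have "(x, y) \<in> (adj_rel E)\<^sup>*" by (auto simp: connected_graph_def)
    then obtain z where "(x, z) \<in> adj_rel E" using y(2) by (meson converse_rtranclE)
    then have "set (nbs ! x) \<noteq> {}"
      using nbs that by (auto simp: adjacency_lists_def adj_rel_def)
    then show ?thesis by (simp add: deg_def Suc_le_eq)
  qed
  then have "(\<Sum>x<n. 1) \<le> (\<Sum>x<n. deg x)" by (intro sum_mono) simp
  then show "n \<le> 2 * card E" using sum_deg[of n] off_le_edges by simp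
qed

end

text \<open>Without an edge between \<open>S\<close> and \<open>T\<close> the boundary is empty and
  the product of \<open>card E\<close> with its size is 0, whereas every execution takes time. Hence
  the product bound is claimed for connected graphs with both sides nonempty, and a bound with
  additive terms for all inputs.\<close>

theorem theorem31:
  shows "\<exists>(alg :: prog) (C :: nat). \<forall>(n :: nat) (E :: nat set set) (S :: nat set) (T :: nat set) nbs.
    simple_graph {..<n} E \<and> S \<subseteq> {..<n} \<and> T = {..<n} - S \<and> T \<noteq> {} \<and> adjacency_lists n E nbs \<longrightarrow>
    (\<exists>t s'. exec alg (input_state n nbs S) t s' \<and>
       (\<forall>v\<in>S. ereal (3/5) * ereal_of_enat (ecc_to E T v) - 1 \<le> ereal_of_enat (estimate n s' v) \<and>
               estimate n s' v \<le> ecc_to E T v) \<and>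
       (connected_graph {..<n} E \<and> S \<noteq> {} \<longrightarrow> t \<le> C * (card E * card (boundary E S T))) \<and>
       t \<le> C * ((n + card E) * (card (boundary E S T) + 1)))"
proof (rule exI[of _ eccentricities], rule exI[of _ 4800], intro allI impI, elim conjE)
  fix n :: nat and E :: "nat set set" and S T :: "nat set" and nbs
  assume a: "simple_graph {..<n} E" "S \<subseteq> {..<n}" "T = {..<n} - S" "T \<noteq> {}" "adjacency_lists n E nbs"
  interpret encoded_graph n E S T "boundary E S T" nbs
    by unfold_locales (use a in \<open>auto simp: boundary_def\<close>)
  let ?B = "card (boundary E S T)"
  from run_eccentricities obtain t s' where
    e: "exec eccentricities (input_state n nbs S) t s'" and
    t: "t \<le> 400 * (n + off n + 1) * (?B + 1)" and
    est: "\<forall>v<n. arrs s' 3 v = est v"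
    unfolding run_def by blast
  have n: "1 \<le> n" using T_ne T by auto
  have "n + off n + 1 \<le> 2 * (n + card E)" using off_le_edges n by simp
  then have "(n + off n + 1) * (?B + 1) \<le> 2 * (n + card E) * (?B + 1)" by (rule mult_le_mono1)
  with t have t2: "t \<le> 800 * ((n + card E) * (?B + 1))" by (simp only: mult.assoc)
  \<comment> \<open>The constant is 800 * 3 * 2: replacing \<open>n\<close> by edges costs a factor
    3, and replacing \<open>?B + 1\<close> by \<open>?B\<close> a factor 2. The 800 comes from 400
    and \<open>n + off n + 1 \<le> 2 * (n + card E)\<close>.\<close>
  have t1: "t \<le> 4800 * (card E * ?B)" if "connected_graph {..<n} E" "S \<noteq> {}"
  proof -
    have "n + card E \<le> 3 * card E" "?B + 1 \<le> 2 * ?B" using connected_bounds[OF that] by simp_all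
    then have "(n + card E) * (?B + 1) \<le> (3 * card E) * (2 * ?B)" by (rule mult_le_mono)
    with t2 show ?thesis by simp
  qed
  have "arrs s' 3 v = est v" if "v \<in> S" for v using est that S by auto
  with e t1 t2 est_approximates
  show "\<exists>t s'. exec eccentricities (input_state n nbs S) t s' \<and>
       (\<forall>v\<in>S. ereal (3/5) * ereal_of_enat (ecc_to E T v) - 1 \<le> ereal_of_enat (estimate n s' v) \<and>
               estimate n s' v \<le> ecc_to E T v) \<and>
       (connected_graph {..<n} E \<and> S \<noteq> {} \<longrightarrow> t \<le> 4800 * (card E * card (boundary E S T))) \<and>
       t \<le> 4800 * ((n + card E) * (card (boundary E S T) + 1))"
    by (intro exI[of _ t] exI[of _ s']) auto
qed

end
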